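(* Let $\mathfrak{C}=(V,\langle\cdot,\cdot\rangle,J,A)$ be a complex curvature model. Then $A$ belongs to $\mathcal{W}_G$ if and only if there exist a Hermitian manifold $\mathcal{M}=(M,g,\mathcal{J})$ and a point $P\in M$ such that $\mathfrak{C}$ is geometrically realized by $\mathcal{M}$ at $P$.
   Context: Let $V$ be a real vector space of dimension $2n\ge 4$, $\langle\cdot,\cdot\rangle$ a positive definite symmetric inner product on $V$, and $J$ a Hermitian complex structure on $V$, i.e. a linear map $J:V\to V$ with $J^2=-\operatorname{id}$ and $\langle Jx,Jy\rangle=\langle x,y\rangle$ for all $x,y$. The space $\mathfrak{A}\subset\otimes^4V^*$ of algebraic curvature tensors consists of all $A$ satisfying, for all $x,y,z,w\in V$: $A(x,y,z,w)=-A(y,x,z,w)=A(z,w,x,y)$ and $A(x,y,z,w)+A(y,z,x,w)+A(z,x,y,w)=0$. A complex curvature model is a tuple $\mathfrak{C}=(V,\langle\cdot,\cdot\rangle,J,A)$ where $V$ is a real vector space of dimension $2n\ge 4$, $\langle\cdot,\cdot\rangle$ is a positive definite symmetric inner product on $V$, $J$ is a Hermitian complex structure on $V$, and $A\in\mathfrak{A}$. $\mathcal{W}_G$ is the space of all $A\in\mathfrak{A}$ satisfying the Gray identity: for all $x,y,z,w\in V$, $$A(x,y,z,w)+A(Jx,Jy,Jz,Jw)=A(Jx,Jy,z,w)+A(x,y,Jz,Jw)+A(Jx,y,Jz,w)+A(x,Jy,z,Jw)+A(Jx,y,z,Jw)+A(x,Jy,Jz,w).$$ An almost Hermitian manifold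 is a triple $(M,g,\mathcal{J})$ with $(M,g)$ a smooth Riemannian manifold and $\mathcal{J}$ an almost complex structure on $TM$ with $g(\mathcal{J}x,\mathcal{J}y)=g(x,y)$. It is Hermitian if $\mathcal{J}$ is integrable, i.e. near every point there are local coordinates $(x_1,\dots,x_n,y_1,\dots,y_n)$ with $\mathcal{J}\partial_{x_i}=\partial_{y_i}$ and $\mathcal{J}\partial_{y_i}=-\partial_{x_i}$. Manifolds need be neither compact nor complete. $R$ denotes the Riemann curvature tensor as a $(0,4)$-tensor, with the sign convention that $R(x,y,y,x)$ is the sectional curvature for orthonormal $x,y$. The model $\mathfrak{C}$ is geometrically realized by $(M,g,\mathcal{J})$ at $P\in M$ if there is a linear isomorphism $\phi:V\to T_PM$ with $\langle\cdot,\cdot\rangle=\phi^*g_P$, $J=\phi^*\mathcal{J}_P$ (i.e. $J=\phi^{-1}\mathcal{J}_P\phi$), and $A=\phi^*R_P$. *)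

theory Defs
  imports "HOL-Analysis.Analysis"
begin

section \<open>Complex curvature models and the Gray identity\<close>

definition inner_product_on_space :: "('v::real_vector \<Rightarrow> 'v \<Rightarrow> real) \<Rightarrow> bool" where
  "inner_product_on_space ip \<longleftrightarrow>
     (\<forall>x. linear (ip x)) \<and> (\<forall>x y. ip x y = ip y x) \<and> (\<forall>x. x \<noteq> 0 \<longrightarrow> ip x x > 0)"

definition hermitian_complex_structure ::
    "('v::real_vector \<Rightarrow> 'v \<Rightarrow> real) \<Rightarrow> ('v \<Rightarrow> 'v) \<Rightarrow> bool" where
  "hermitian_complex_structure ip J \<longleftrightarrow>
     linear J \<and> (\<forall>x. J (J x) = - x) \<and> (\<forall>x y. ip (J x) (J y) = ip x y)"

definition curvature_tensors :: "('v::real_vector \<Rightarrow> 'v \<Rightarrow> 'v \<Rightarrow> 'v \<Rightarrow> real) set" where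
  "curvature_tensors = {A.
     (\<forall>y z w. linear (\<lambda>x. A x y z w)) \<and> (\<forall>x z w. linear (\<lambda>y. A x y z w)) \<and>
     (\<forall>x y w. linear (\<lambda>z. A x y z w)) \<and> (\<forall>x y z. linear (\<lambda>w. A x y z w)) \<and>
     (\<forall>x y z w. A x y z w = - A y x z w) \<and>
     (\<forall>x y z w. A x y z w = A z w x y) \<and>
     (\<forall>x y z w. A x y z w + A y z x w + A z x y w = 0)}"

definition gray_space ::
    "('v::real_vector \<Rightarrow> 'v) \<Rightarrow> ('v \<Rightarrow> 'v \<Rightarrow> 'v \<Rightarrow> 'v \<Rightarrow> real) set" where
  "gray_space J = {A \<in> curvature_tensors. \<forall>x y z w.
     A x y z w + A (J x) (J y) (J z) (J w) =
       A (J x) (J y) z w + A x y (J z) (J w) + A (J x) y (J z) w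
       + A x (J y) z (J w) + A (J x) y z (J w) + A x (J y) (J z) w}"

definition complex_curvature_model ::
    "nat \<Rightarrow> ('v::real_vector \<Rightarrow> 'v \<Rightarrow> real) \<Rightarrow> ('v \<Rightarrow> 'v) \<Rightarrow>
     ('v \<Rightarrow> 'v \<Rightarrow> 'v \<Rightarrow> 'v \<Rightarrow> real) \<Rightarrow> bool" where
  "complex_curvature_model n ip J A \<longleftrightarrow>
     n \<ge> 2 \<and> dim (UNIV :: 'v set) = 2 * n \<and> inner_product_on_space ip \<and>
     hermitian_complex_structure ip J \<and> A \<in> curvature_tensors"


section \<open>Smooth manifolds\<close>

text \<open>The set \<open>S\<close> is open in all uses, so \<open>k\<close>-fold Frechet differentiability in every
  fixed sequence of directions, for all \<open>k\<close>, is the usual notion of being of class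
  \<open>C\<close>-infinity.\<close>

primrec k_smooth_on ::
    "nat \<Rightarrow> 'a::real_normed_vector set \<Rightarrow> ('a \<Rightarrow> 'b::real_normed_vector) \<Rightarrow> bool" where
  "k_smooth_on 0 S f \<longleftrightarrow> continuous_on S f"
| "k_smooth_on (Suc k) S f \<longleftrightarrow>
     (\<forall>x\<in>S. f differentiable (at x)) \<and>
     (\<forall>v. k_smooth_on k S (\<lambda>x. frechet_derivative f (at x) v))"

definition smooth_on ::
    "'a::real_normed_vector set \<Rightarrow> ('a \<Rightarrow> 'b::real_normed_vector) \<Rightarrow> bool" where
  "smooth_on S f \<longleftrightarrow> (\<forall>k. k_smooth_on k S f)"

text \<open>A chart is a pair of its domain and the coordinate map; the values of the map outside
  the domain are irrelevant.\<close>

type_synonym ('m, 'e) chart = "'m set \<times> ('m \<Rightarrow> 'e)"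

abbreviation chart_range :: "('m, 'e) chart \<Rightarrow> 'e set" where
  "chart_range c \<equiv> snd c ` fst c"

abbreviation chart_inv :: "('m, 'e) chart \<Rightarrow> 'e \<Rightarrow> 'm" where
  "chart_inv c \<equiv> inv_into (fst c) (snd c)"

definition chart_on :: "'m topology \<Rightarrow> ('m, 'e::euclidean_space) chart \<Rightarrow> bool" where
  "chart_on X c \<longleftrightarrow> openin X (fst c) \<and> open (chart_range c) \<and>
     homeomorphic_map (subtopology X (fst c)) (top_of_set (chart_range c)) (snd c)"

definition transition :: "('m, 'e) chart \<Rightarrow> ('m, 'e) chart \<Rightarrow> 'e \<Rightarrow> 'e" where
  "transition c d = (\<lambda>q. snd d (chart_inv c q))"

definition compatible :: "('m, 'e::euclidean_space) chart \<Rightarrow> ('m, 'e) chart \<Rightarrow> bool" where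
  "compatible c d \<longleftrightarrow>
     smooth_on (snd c ` (fst c \<inter> fst d)) (transition c d) \<and>
     smooth_on (snd d ` (fst c \<inter> fst d)) (transition d c)"

record ('m, 'e) manifold =
  mtop :: "'m topology"
  atlas :: "('m, 'e) chart set"

text \<open>The atlas need not be maximal; the local coordinate systems of the manifold are the
  charts compatible with the whole atlas.\<close>

definition local_coordinates ::
    "('m, 'e::euclidean_space, 'z) manifold_scheme \<Rightarrow> ('m, 'e) chart \<Rightarrow> bool" where
  "local_coordinates M c \<longleftrightarrow> chart_on (mtop M) c \<and> (\<forall>d\<in>atlas M. compatible c d)"

definition smooth_manifold :: "('m, 'e::euclidean_space, 'z) manifold_scheme \<Rightarrow> bool" where
  "smooth_manifold M \<longleftrightarrow>
     Hausdorff_space (mtop M) \<and> second_countable (mtop M) \<and>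
     (\<forall>c\<in>atlas M. local_coordinates M c) \<and> (\<Union>c\<in>atlas M. fst c) = topspace (mtop M)"


section \<open>Tangent vectors\<close>

text \<open>A tangent vector at \<open>P\<close> is the family of its components in the charts of the atlas
  around \<open>P\<close>, transforming by the derivatives of the transition maps. The family is set to zero
  at all other charts, so that vectors are determined by their components. The vector space
  operations are pointwise.\<close>

type_synonym ('m, 'e) tvec = "('m, 'e) chart \<Rightarrow> 'e"

definition charts_at :: "('m, 'e, 'z) manifold_scheme \<Rightarrow> 'm \<Rightarrow> ('m, 'e) chart set" where
  "charts_at M P = {c \<in> atlas M. P \<in> fst c}"

definition tangent_space ::
    "('m, 'e::euclidean_space, 'z) manifold_scheme \<Rightarrow> 'm \<Rightarrow> ('m, 'e) tvec set" where
  "tangent_space M P = {u.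
     (\<forall>c\<in>charts_at M P. \<forall>d\<in>charts_at M P.
        u d = frechet_derivative (transition c d) (at (snd c P)) (u c)) \<and>
     (\<forall>c. c \<notin> charts_at M P \<longrightarrow> u c = 0)}"

definition tlincomb ::
    "real \<Rightarrow> ('m, 'e::euclidean_space) tvec \<Rightarrow> real \<Rightarrow> ('m, 'e) tvec \<Rightarrow> ('m, 'e) tvec" where
  "tlincomb r u s v = (\<lambda>c. r *\<^sub>R u c + s *\<^sub>R v c)"

text \<open>The tangent vector at \<open>P\<close> with component vector \<open>a\<close> in the local coordinates \<open>c\<close>
  (which need not belong to the atlas); for basis vectors \<open>a\<close> these are the coordinate vector
  fields of \<open>c\<close>.\<close>

definition coord_vec ::
    "('m, 'e::euclidean_space, 'z) manifold_scheme \<Rightarrow> ('m, 'e) chart \<Rightarrow> 'm \<Rightarrow> 'e \<Rightarrow> ('m, 'e) tvec"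
  where
  "coord_vec M c P a = (\<lambda>d. if d \<in> charts_at M P
     then frechet_derivative (transition c d) (at (snd c P)) a else 0)"


section \<open>Hermitian manifolds\<close>

record ('m, 'e) almost_hermitian = "('m, 'e) manifold" +
  metric :: "'m \<Rightarrow> ('m, 'e) tvec \<Rightarrow> ('m, 'e) tvec \<Rightarrow> real"
  acs :: "'m \<Rightarrow> ('m, 'e) tvec \<Rightarrow> ('m, 'e) tvec"

definition metric_in_chart ::
    "('m, 'e::euclidean_space, 'z) almost_hermitian_scheme \<Rightarrow> ('m, 'e) chart \<Rightarrow>
     'e \<Rightarrow> 'e \<Rightarrow> 'e \<Rightarrow> real" where
  "metric_in_chart M c q a b =
     (let P = chart_inv c q in metric M P (coord_vec M c P a) (coord_vec M c P b))"

definition acs_in_chart ::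
    "('m, 'e::euclidean_space, 'z) almost_hermitian_scheme \<Rightarrow> ('m, 'e) chart \<Rightarrow> 'e \<Rightarrow> 'e \<Rightarrow> 'e"
  where
  "acs_in_chart M c q a = (let P = chart_inv c q in acs M P (coord_vec M c P a) c)"

definition riemannian_metric ::
    "('m, 'e::euclidean_space, 'z) almost_hermitian_scheme \<Rightarrow> bool" where
  "riemannian_metric M \<longleftrightarrow>
     (\<forall>P\<in>topspace (mtop M). \<forall>u\<in>tangent_space M P. \<forall>v\<in>tangent_space M P.
        metric M P u v = metric M P v u \<and>
        (\<forall>w\<in>tangent_space M P. \<forall>r s.
           metric M P (tlincomb r u s v) w = r * metric M P u w + s * metric M P v w) \<and>
        (u \<noteq> (\<lambda>c. 0) \<longrightarrow> metric M P u u > 0)) \<and>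
     (\<forall>c\<in>atlas M. \<forall>a b. smooth_on (chart_range c) (\<lambda>q. metric_in_chart M c q a b))"

definition almost_complex_structure ::
    "('m, 'e::euclidean_space, 'z) almost_hermitian_scheme \<Rightarrow> bool" where
  "almost_complex_structure M \<longleftrightarrow>
     (\<forall>P\<in>topspace (mtop M). \<forall>u\<in>tangent_space M P.
        acs M P u \<in> tangent_space M P \<and>
        (\<forall>v\<in>tangent_space M P. \<forall>r s.
           acs M P (tlincomb r u s v) = tlincomb r (acs M P u) s (acs M P v)) \<and>
        acs M P (acs M P u) = (\<lambda>c. - u c)) \<and>
     (\<forall>c\<in>atlas M. \<forall>a. smooth_on (chart_range c) (\<lambda>q. acs_in_chart M c q a))"

definition almost_hermitian_manifold ::
    "('m, 'e::euclidean_space, 'z) almost_hermitian_scheme \<Rightarrow> bool" where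
  "almost_hermitian_manifold M \<longleftrightarrow>
     smooth_manifold M \<and> riemannian_metric M \<and> almost_complex_structure M \<and>
     (\<forall>P\<in>topspace (mtop M). \<forall>u\<in>tangent_space M P. \<forall>v\<in>tangent_space M P.
        metric M P (acs M P u) (acs M P v) = metric M P u v)"

text \<open>The coordinate space of dimension \<open>2n\<close>, with points \<open>(x, y)\<close>, where
  \<open>n = CARD('n)\<close>.\<close>

type_synonym 'n xy_space = "(real ^ 'n) \<times> (real ^ 'n)"

definition integrable_acs ::
    "('m, 'n::finite xy_space, 'z) almost_hermitian_scheme \<Rightarrow> bool" where
  "integrable_acs M \<longleftrightarrow>
     (\<forall>P\<in>topspace (mtop M). \<exists>c. local_coordinates M c \<and> P \<in> fst c \<and>
        (\<forall>Q\<in>fst c. \<forall>i::'n.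
           acs M Q (coord_vec M c Q (axis i 1, 0)) = coord_vec M c Q (0, axis i 1) \<and>
           acs M Q (coord_vec M c Q (0, axis i 1)) = (\<lambda>d. - coord_vec M c Q (axis i 1, 0) d)))"

definition hermitian_manifold ::
    "('m, 'n::finite xy_space, 'z) almost_hermitian_scheme \<Rightarrow> bool" where
  "hermitian_manifold M \<longleftrightarrow> almost_hermitian_manifold M \<and> integrable_acs M"


section \<open>The Riemann curvature tensor\<close>

text \<open>In a chart, \<open>h\<close> is the metric and vector fields are functions \<open>X :: 'e \<Rightarrow> 'e\<close>. The
  Christoffel term is determined by the Koszul formula for constant (hence commuting) fields.\<close>

definition christoffel ::
    "('e \<Rightarrow> 'e \<Rightarrow> 'e \<Rightarrow> real) \<Rightarrow> 'e::euclidean_space \<Rightarrow> 'e \<Rightarrow> 'e \<Rightarrow> 'e" where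
  "christoffel h q a b = (THE v. \<forall>c.
     2 * h q v c = frechet_derivative (\<lambda>p. h p b c) (at q) a
                 + frechet_derivative (\<lambda>p. h p a c) (at q) b
                 - frechet_derivative (\<lambda>p. h p a b) (at q) c)"

definition cov_deriv ::
    "('e \<Rightarrow> 'e \<Rightarrow> 'e \<Rightarrow> real) \<Rightarrow> ('e \<Rightarrow> 'e) \<Rightarrow> ('e \<Rightarrow> 'e) \<Rightarrow> 'e::euclidean_space \<Rightarrow> 'e" where
  "cov_deriv h X Y = (\<lambda>q. frechet_derivative Y (at q) (X q) + christoffel h q (X q) (Y q))"

definition lie_bracket :: "('e \<Rightarrow> 'e) \<Rightarrow> ('e \<Rightarrow> 'e) \<Rightarrow> 'e::euclidean_space \<Rightarrow> 'e" where
  "lie_bracket X Y =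
     (\<lambda>q. frechet_derivative Y (at q) (X q) - frechet_derivative X (at q) (Y q))"

definition curvature_operator ::
    "('e \<Rightarrow> 'e \<Rightarrow> 'e \<Rightarrow> real) \<Rightarrow> ('e \<Rightarrow> 'e) \<Rightarrow> ('e \<Rightarrow> 'e) \<Rightarrow> ('e \<Rightarrow> 'e) \<Rightarrow>
     'e::euclidean_space \<Rightarrow> 'e" where
  "curvature_operator h X Y Z = (\<lambda>q.
     cov_deriv h X (cov_deriv h Y Z) q - cov_deriv h Y (cov_deriv h X Z) q
     - cov_deriv h (lie_bracket X Y) Z q)"

text \<open>Tangent vectors at \<open>P\<close> are extended to vector fields with constant components in some
  chart of the atlas around \<open>P\<close>; by tensoriality the choice of the chart is immaterial. With
  \<open>R(x,y,z,w) = g(R(x,y)z, w)\<close> and the above sign of \<open>R(x,y)\<close>, the number \<open>R(x,y,y,x)\<close> is the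
  sectional curvature for orthonormal \<open>x, y\<close>.\<close>

definition riemann_tensor ::
    "('m, 'e::euclidean_space, 'z) almost_hermitian_scheme \<Rightarrow> 'm \<Rightarrow>
     ('m, 'e) tvec \<Rightarrow> ('m, 'e) tvec \<Rightarrow> ('m, 'e) tvec \<Rightarrow> ('m, 'e) tvec \<Rightarrow> real" where
  "riemann_tensor M P x y z w =
     (let c = (SOME c. c \<in> charts_at M P); h = metric_in_chart M c; q = snd c P
      in h q (curvature_operator h (\<lambda>_. x c) (\<lambda>_. y c) (\<lambda>_. z c) q) (w c))"


section \<open>Geometric realization\<close>

definition geometrically_realized ::
    "('v::real_vector \<Rightarrow> 'v \<Rightarrow> real) \<Rightarrow> ('v \<Rightarrow> 'v) \<Rightarrow> ('v \<Rightarrow> 'v \<Rightarrow> 'v \<Rightarrow> 'v \<Rightarrow> real) \<Rightarrow>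
     ('m, 'e::euclidean_space, 'z) almost_hermitian_scheme \<Rightarrow> 'm \<Rightarrow> bool" where
  "geometrically_realized ip J A M P \<longleftrightarrow> P \<in> topspace (mtop M) \<and>
     (\<exists>\<phi>. bij_betw \<phi> UNIV (tangent_space M P) \<and>
        (\<forall>x y r s. \<phi> (r *\<^sub>R x + s *\<^sub>R y) = tlincomb r (\<phi> x) s (\<phi> y)) \<and>
        (\<forall>x y. ip x y = metric M P (\<phi> x) (\<phi> y)) \<and>
        (\<forall>x. \<phi> (J x) = acs M P (\<phi> x)) \<and>
        (\<forall>x y z w. A x y z w = riemann_tensor M P (\<phi> x) (\<phi> y) (\<phi> z) (\<phi> w)))"

end

theory Submission
  imports Defs
begin

text \<open>
  In local coordinates adapted to the complex structure, \<open>J\<close> is constant and the metric \<open>H\<close> satisfies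
  \<open>H(Ja, Jb) = H(a, b)\<close>. There the curvature is a sum of second derivatives of \<open>H\<close>, whose
  contribution to the Gray identity cancels term by term, and of products
  \<open>\<langle>\<nabla>\<^sub>a X\<^sub>c, \<nabla>\<^sub>b X\<^sub>d\<rangle>\<close>. For the latter put \<open>S = \<nabla>\<^sub>a X\<^sub>c - \<nabla>\<^bsub>Ja\<^esub> X\<^bsub>Jc\<^esub>\<close> and
  \<open>U = \<nabla>\<^bsub>Ja\<^esub> X\<^sub>c + \<nabla>\<^sub>a X\<^bsub>Jc\<^esub>\<close>; the Koszul formula gives \<open>U = J S\<close>, and the Gray expression equals
  \<open>\<langle>S, S'\<rangle> - \<langle>U, U'\<rangle> = 0\<close>. The atlas need not contain the adapted coordinates, so the
  computation is carried out in a chart of the atlas with the coordinate fields \<open>X\<^sub>a\<close> of the adapted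
  system as a moving frame.

  Conversely, the Hermitian metric \<open>\<langle>a, b\<rangle> + \<Theta>(q, q, a, b)\<close> has vanishing Christoffel symbols at the
  origin, so its curvature there is a linear expression in \<open>\<Theta>\<close>; an explicit combination of the
  values of \<open>A\<close> on arguments with and without \<open>J\<close> yields a \<open>\<Theta>\<close> for which this expression is \<open>A\<close>.
\<close>

section \<open>Calculus\<close>

abbreviation pd :: "'a::real_normed_vector \<Rightarrow> ('a \<Rightarrow> 'b::real_normed_vector) \<Rightarrow> 'a \<Rightarrow> 'b" where
  "pd a f q \<equiv> frechet_derivative f (at q) a"

lemma pd_eqI: "(f has_derivative f') (at q) \<Longrightarrow> pd a f q = f' a"
  by (simp add: frechet_derivative_at[symmetric])

lemma has_derivative_pd: "f differentiable (at q) \<Longrightarrow> (f has_derivative (\<lambda>a. pd a f q)) (at q)"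
  by (simp add: frechet_derivative_works)

lemma linear_pd: "f differentiable (at q) \<Longrightarrow> linear (\<lambda>a. pd a f q)"
  using has_derivative_pd has_derivative_linear by blast

section \<open>Locality of derivatives and of smoothness\<close>

lemma differentiable_cong_open:
  assumes "open S" "q \<in> S" "\<And>p. p \<in> S \<Longrightarrow> f p = g p" "f differentiable (at q)"
  shows "g differentiable (at q)"
  using assms has_derivative_transform_within_open unfolding differentiable_def by blast

text \<open>Both functions have the same set of derivatives at \<open>q\<close>, so the choice
  operator in \<open>frechet_derivative\<close> returns the same map even where neither function is
  differentiable.\<close>

lemma pd_cong_open:
  assumes "open S" "q \<in> S" "\<And>p. p \<in> S \<Longrightarrow> f p = g p"
  shows "pd a f q = pd a g q"
proof -
  have "(f has_derivative f') (at q) \<longleftrightarrow> (g has_derivative f') (at q)" for f'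
    using has_derivative_transform_within_open[of f f' q UNIV S g]
      has_derivative_transform_within_open[of g f' q UNIV S f] assms by auto
  then show ?thesis unfolding frechet_derivative_def by simp
qed

lemma k_smooth_on_cong:
  assumes "open S" "\<And>p. p \<in> S \<Longrightarrow> f p = g p"
  shows "k_smooth_on k S f \<Longrightarrow> k_smooth_on k S g"
  using assms(2)
proof (induction k arbitrary: f g)
  case 0
  then show ?case by (simp cong: continuous_on_cong)
next
  case (Suc k)
  have "k_smooth_on k S (\<lambda>x. pd v g x)" for v
  proof (rule Suc.IH)
    show "k_smooth_on k S (\<lambda>x. pd v f x)" using Suc.prems by simp
    show "pd v f p = pd v g p" if "p \<in> S" for p
      by (rule pd_cong_open[OF assms(1) that Suc.prems(2)])
  qed
  then show ?case
    using Suc.prems differentiable_cong_open[OF assms(1)] by (metis k_smooth_on.simps(2))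
qed

lemma smooth_on_cong:
  "\<lbrakk>open S; smooth_on S f; \<And>p. p \<in> S \<Longrightarrow> f p = g p\<rbrakk> \<Longrightarrow> smooth_on S g"
  unfolding smooth_on_def using k_smooth_on_cong by blast

lemma smooth_on_differentiable: "smooth_on S f \<Longrightarrow> x \<in> S \<Longrightarrow> f differentiable (at x)"
  unfolding smooth_on_def by (metis k_smooth_on.simps(2))

lemma smooth_on_pd: "smooth_on S f \<Longrightarrow> smooth_on S (pd v f)"
  unfolding smooth_on_def by (metis k_smooth_on.simps(2))

section \<open>Symmetry of second derivatives\<close>

text \<open>The mean value theorem in direction \<open>v\<close> turns the second difference into a
  difference of two values of the partial derivative along \<open>v\<close>, and the first-order
  expansion of that partial derivative at \<open>q\<close> evaluates both.\<close>

lemma second_difference: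
  fixes f :: "'a::real_normed_vector \<Rightarrow> real"
  assumes "open S" "q \<in> S" and df: "\<And>p. p \<in> S \<Longrightarrow> (f has_derivative f' p) (at p)"
    and d2: "((\<lambda>p. f' p v) has_derivative f'') (at q)" and "e > 0"
  shows "\<exists>d>0. \<forall>t. 0 < t \<and> t < d \<longrightarrow>
    \<bar>f (q + t *\<^sub>R u + t *\<^sub>R v) - f (q + t *\<^sub>R u) - f (q + t *\<^sub>R v) + f q - t\<^sup>2 * f'' u\<bar> \<le> e * t\<^sup>2"
proof -
  \<comment> \<open>All points of the parallelogram spanned by \<open>t *\<^sub>R u\<close> and
    \<open>t *\<^sub>R v\<close> at \<open>q\<close> lie within \<open>t * m\<close> of
    \<open>q\<close>; the summand 1 keeps \<open>m\<close> positive when \<open>u\<close> and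
    \<open>v\<close> vanish.\<close>
  define m where "m = norm u + norm v + 1"
  have m: "m > 0" unfolding m_def by (simp add: add_nonneg_pos)
  obtain r where r: "r > 0" "ball q r \<subseteq> S" using assms(1,2) openE by blast
  \<comment> \<open>Two expansions get subtracted, so each may use up half of the final error
    \<open>e * t\<close>.\<close>
  have "e / (2 * m) > 0" using m \<open>e > 0\<close> by simp
  then obtain d0 where d0: "d0 > 0"
    "\<And>y. norm (y - q) < d0 \<Longrightarrow> norm (f' y v - f' q v - f'' (y - q)) \<le> e / (2 * m) * norm (y - q)"
    using d2 unfolding has_derivative_at_alt by meson
  define d where "d = min r d0 / m"
  have "d > 0" using r d0 m by (simp add: d_def)
  have lin: "linear f''" using d2 has_derivative_linear by blast
  have "\<bar>f (q + t *\<^sub>R u + t *\<^sub>R v) - f (q + t *\<^sub>R u) - f (q + t *\<^sub>R v) + f q - t\<^sup>2 * f'' u\<bar> \<le> e * t\<^sup>2"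
    if t: "0 < t" "t < d" for t
  proof -
    have tm: "t * m < r" "t * m < d0"
      using t m unfolding d_def by (simp_all add: pos_less_divide_eq)
    have nb: "norm (x *\<^sub>R v + y *\<^sub>R u) \<le> t * m" if "0 \<le> x" "x \<le> t" "0 \<le> y" "y \<le> t" for x y
    proof -
      have "norm (x *\<^sub>R v + y *\<^sub>R u) \<le> x * norm v + y * norm u"
        using norm_triangle_ineq[of "x *\<^sub>R v" "y *\<^sub>R u"] that by simp
      also have "\<dots> \<le> t * norm v + t * norm u" using that by (intro add_mono mult_right_mono) auto
      also have "\<dots> \<le> t * m" using t by (simp add: m_def algebra_simps)
      finally show ?thesis .
    qed
    have inS: "q + (x *\<^sub>R v + y *\<^sub>R u) \<in> S" if "0 \<le> x" "x \<le> t" "0 \<le> y" "y \<le> t" for x y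
    proof -
      have "dist (q + (x *\<^sub>R v + y *\<^sub>R u)) q < r" using nb[OF that] tm by (simp add: dist_norm)
      then show ?thesis using r(2) by (auto simp: mem_ball dist_commute)
    qed
    \<comment> \<open>The zero multiple of \<open>u\<close> is written out so that both terms are
      the cases \<open>y = t\<close> and \<open>y = 0\<close> of one derivative computation.\<close>
    define F where "F s = f (q + (s *\<^sub>R v + t *\<^sub>R u)) - f (q + (s *\<^sub>R v + 0 *\<^sub>R u))" for s
    have dF: "(F has_real_derivative (f' (q + (s *\<^sub>R v + t *\<^sub>R u)) v - f' (q + (s *\<^sub>R v + 0 *\<^sub>R u)) v)) (at s)"
      if s: "0 \<le> s" "s \<le> t" for s
    proof -
      have "((\<lambda>s. f (q + (s *\<^sub>R v + y *\<^sub>R u))) has_derivative (\<lambda>k. k * f' (q + (s *\<^sub>R v + y *\<^sub>R u)) v)) (at s)"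
        if y: "0 \<le> y" "y \<le> t" for y
      proof -
        have "((\<lambda>s. q + (s *\<^sub>R v + y *\<^sub>R u)) has_derivative (\<lambda>k. k *\<^sub>R v)) (at s)"
          by (auto intro!: derivative_eq_intros)
        from has_derivative_compose[OF this df[OF inS[OF s y]]]
        show ?thesis
          by (simp add: linear_scale[OF has_derivative_linear[OF df[OF inS[OF s y]]]])
      qed
      from has_derivative_diff[OF this[of t] this[of 0]]
      show ?thesis unfolding F_def has_field_derivative_def
        by (rule has_derivative_eq_rhs) (use t in \<open>auto simp: algebra_simps\<close>)
    qed
    obtain z where z: "0 < z" "z < t"
      "F t - F 0 = (t - 0) * (f' (q + (z *\<^sub>R v + t *\<^sub>R u)) v - f' (q + (z *\<^sub>R v + 0 *\<^sub>R u)) v)"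
      using MVT2[of 0 t F, OF t(1) dF] by auto
    have e1: "\<bar>f' (q + (z *\<^sub>R v + y *\<^sub>R u)) v - f' q v - f'' (z *\<^sub>R v + y *\<^sub>R u)\<bar> \<le> e / 2 * t"
      if "0 \<le> y" "y \<le> t" for y
    proof -
      have n: "norm (z *\<^sub>R v + y *\<^sub>R u) \<le> t * m" using nb z that by auto
      have "\<bar>f' (q + (z *\<^sub>R v + y *\<^sub>R u)) v - f' q v - f'' (z *\<^sub>R v + y *\<^sub>R u)\<bar>
          \<le> e / (2 * m) * norm (z *\<^sub>R v + y *\<^sub>R u)"
        using d0(2)[of "q + (z *\<^sub>R v + y *\<^sub>R u)"] n tm by simp
      also have "\<dots> \<le> e / (2 * m) * (t * m)" using n m \<open>e > 0\<close> by (intro mult_left_mono) auto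
      also have "\<dots> = e / 2 * t" using m by simp
      finally show ?thesis .
    qed
    have "f'' (z *\<^sub>R v + t *\<^sub>R u) - f'' (z *\<^sub>R v + 0 *\<^sub>R u) = t * f'' u"
      using lin by (simp add: linear_add linear_scale)
    then have "\<bar>(f' (q + (z *\<^sub>R v + t *\<^sub>R u)) v - f' (q + (z *\<^sub>R v + 0 *\<^sub>R u)) v) - t * f'' u\<bar> \<le> e * t"
      using e1[of t] e1[of 0] t by linarith
    then have "t * \<bar>(f' (q + (z *\<^sub>R v + t *\<^sub>R u)) v - f' (q + (z *\<^sub>R v + 0 *\<^sub>R u)) v) - t * f'' u\<bar> \<le> t * (e * t)"
      using t by (intro mult_left_mono) auto
    then have "\<bar>t * ((f' (q + (z *\<^sub>R v + t *\<^sub>R u)) v - f' (q + (z *\<^sub>R v + 0 *\<^sub>R u)) v) - t * f'' u)\<bar> \<le> t * (e * t)"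
      using t by (simp only: abs_mult abs_of_pos)
    also have "t * ((f' (q + (z *\<^sub>R v + t *\<^sub>R u)) v - f' (q + (z *\<^sub>R v + 0 *\<^sub>R u)) v) - t * f'' u) =
        F t - F 0 - t\<^sup>2 * f'' u"
      unfolding z(3) by (simp add: power2_eq_square algebra_simps)
    finally show ?thesis unfolding F_def by (simp add: algebra_simps power2_eq_square)
  qed
  then show ?thesis using \<open>d > 0\<close> by blast
qed

text \<open>The second difference is symmetric in \<open>u\<close> and \<open>v\<close>, so both
  iterated derivatives, multiplied by \<open>t\<^sup>2\<close>, approximate the same
  quantity.\<close>

lemma second_derivative_symmetric_real:
  fixes f :: "'a::real_normed_vector \<Rightarrow> real"
  assumes "open S" "q \<in> S" and "\<And>p. p \<in> S \<Longrightarrow> f differentiable (at p)"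
    and d2: "\<And>v. pd v f differentiable (at q)"
  shows "pd u (pd v f) q = pd v (pd u f) q"
proof -
  have df: "\<And>p. p \<in> S \<Longrightarrow> (f has_derivative (\<lambda>a. pd a f p)) (at p)"
    using assms has_derivative_pd by blast
  have "\<bar>pd u (pd v f) q - pd v (pd u f) q\<bar> \<le> 2 * e" if e: "e > 0" for e
  proof -
    let ?D = "\<lambda>t. f (q + t *\<^sub>R u + t *\<^sub>R v) - f (q + t *\<^sub>R u) - f (q + t *\<^sub>R v) + f q"
    obtain d1 where d1: "d1 > 0" "\<And>t. 0 < t \<and> t < d1 \<Longrightarrow> \<bar>?D t - t\<^sup>2 * pd u (pd v f) q\<bar> \<le> e * t\<^sup>2"
      using second_difference[OF assms(1,2) df has_derivative_pd[OF d2] e, of u v] by blast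
    obtain d2' where d2': "d2' > 0" "\<And>t. 0 < t \<and> t < d2' \<Longrightarrow>
        \<bar>f (q + t *\<^sub>R v + t *\<^sub>R u) - f (q + t *\<^sub>R v) - f (q + t *\<^sub>R u) + f q - t\<^sup>2 * pd v (pd u f) q\<bar> \<le> e * t\<^sup>2"
      using second_difference[OF assms(1,2) df has_derivative_pd[OF d2] e, of v u] by blast
    define t where "t = min d1 d2' / 2"
    have t: "0 < t" "t < d1" "t < d2'" using d1 d2' by (auto simp: t_def)
    have a: "q + t *\<^sub>R v + t *\<^sub>R u = q + t *\<^sub>R u + t *\<^sub>R v" by (simp add: algebra_simps)
    have "\<bar>t\<^sup>2 * pd u (pd v f) q - t\<^sup>2 * pd v (pd u f) q\<bar> \<le> 2 * (e * t\<^sup>2)"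
      using d1(2)[of t] d2'(2)[of t] t unfolding a by linarith
    then have "t\<^sup>2 * \<bar>pd u (pd v f) q - pd v (pd u f) q\<bar> \<le> t\<^sup>2 * (2 * e)"
      by (simp add: abs_mult flip: right_diff_distrib) (simp add: algebra_simps)
    then show ?thesis using t by simp
  qed
  \<comment> \<open>A nonzero difference would be bounded by half of its own absolute value.\<close>
  from this[of "\<bar>pd u (pd v f) q - pd v (pd u f) q\<bar> / 4"] show ?thesis by fastforce
qed

lemma second_derivative_symmetric:
  fixes f :: "'a::real_normed_vector \<Rightarrow> 'b::euclidean_space"
  assumes "open S" "q \<in> S" and df: "\<And>p. p \<in> S \<Longrightarrow> f differentiable (at p)"
    and d2: "\<And>v. pd v f differentiable (at q)"
  shows "pd u (pd v f) q = pd v (pd u f) q"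
proof (rule euclidean_eqI)
  fix i :: 'b assume "i \<in> Basis"
  have *: "pd v (\<lambda>p. f p \<bullet> i) p = pd v f p \<bullet> i" if "p \<in> S" for p v
    by (rule pd_eqI) (intro has_derivative_inner_left has_derivative_pd df that)
  have d2i: "(\<lambda>p. pd v f p \<bullet> i) differentiable (at q)" for v
    using has_derivative_inner_left[OF has_derivative_pd[OF d2[of v]]] unfolding differentiable_def by blast
  have **: "pd u (pd v (\<lambda>p. f p \<bullet> i)) q = pd u (pd v f) q \<bullet> i" for u v
  proof -
    have "pd u (pd v (\<lambda>p. f p \<bullet> i)) q = pd u (\<lambda>p. pd v f p \<bullet> i) q"
      by (rule pd_cong_open[OF assms(1,2)]) (rule *)
    also have "\<dots> = pd u (pd v f) q \<bullet> i"
      by (rule pd_eqI) (intro has_derivative_inner_left has_derivative_pd d2)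
    finally show ?thesis .
  qed
  have "pd u (pd v (\<lambda>p. f p \<bullet> i)) q = pd v (pd u (\<lambda>p. f p \<bullet> i)) q"
  proof (rule second_derivative_symmetric_real[OF assms(1,2)])
    show "(\<lambda>p. f p \<bullet> i) differentiable (at p)" if "p \<in> S" for p
      using has_derivative_inner_left[OF has_derivative_pd[OF df[OF that]]] unfolding differentiable_def by blast
    show "pd v (\<lambda>p. f p \<bullet> i) differentiable (at q)" for v
      by (rule differentiable_cong_open[OF assms(1,2) _ d2i[of v]]) (simp add: *)
  qed
  then show "pd u (pd v f) q \<bullet> i = pd v (pd u f) q \<bullet> i" by (simp add: **)
qed

section \<open>Families of bilinear maps\<close>

lemma bilinear_Basis_expand:
  fixes B :: "'a::euclidean_space \<Rightarrow> 'b::euclidean_space \<Rightarrow> 'c::real_vector"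
  assumes "bilinear B"
  shows "B a b = (\<Sum>i\<in>Basis. \<Sum>j\<in>Basis. ((a \<bullet> i) * (b \<bullet> j)) *\<^sub>R B i j)"
proof -
  have "B a b = B (\<Sum>i\<in>Basis. (a \<bullet> i) *\<^sub>R i) (\<Sum>j\<in>Basis. (b \<bullet> j) *\<^sub>R j)"
    by (simp add: euclidean_representation)
  also have "\<dots> = (\<Sum>i\<in>Basis. \<Sum>j\<in>Basis. B ((a \<bullet> i) *\<^sub>R i) ((b \<bullet> j) *\<^sub>R j))"
    unfolding bilinear_sum[OF assms] sum.cartesian_product ..
  finally show ?thesis by (simp add: bilinear_lmul[OF assms] bilinear_rmul[OF assms] mult.commute)
qed

lemma pd_bilinear:
  fixes B :: "'p::real_normed_vector \<Rightarrow> 'a::euclidean_space \<Rightarrow> 'a \<Rightarrow> 'c::real_normed_vector"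
  assumes "open S" "q \<in> S" "\<And>p. p \<in> S \<Longrightarrow> bilinear (B p)"
    and d: "\<And>a b. (\<lambda>p. B p a b) differentiable (at q)"
  shows "bilinear (\<lambda>a b. pd s (\<lambda>p. B p a b) q)"
proof -
  have "pd s (\<lambda>p. B p (a + a') b) q = pd s (\<lambda>p. B p a b) q + pd s (\<lambda>p. B p a' b) q" for a a' b
  proof -
    have "pd s (\<lambda>p. B p (a + a') b) q = pd s (\<lambda>p. B p a b + B p a' b) q"
      by (rule pd_cong_open[OF assms(1,2)]) (simp add: assms(3) bilinear_ladd)
    also have "\<dots> = pd s (\<lambda>p. B p a b) q + pd s (\<lambda>p. B p a' b) q"
      by (rule pd_eqI) (intro has_derivative_add has_derivative_pd d)
    finally show ?thesis .
  qed
  moreover have "pd s (\<lambda>p. B p a (b + b')) q = pd s (\<lambda>p. B p a b) q + pd s (\<lambda>p. B p a b') q" for a b b'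
  proof -
    have "pd s (\<lambda>p. B p a (b + b')) q = pd s (\<lambda>p. B p a b + B p a b') q"
      by (rule pd_cong_open[OF assms(1,2)]) (simp add: assms(3) bilinear_radd)
    also have "\<dots> = pd s (\<lambda>p. B p a b) q + pd s (\<lambda>p. B p a b') q"
      by (rule pd_eqI) (intro has_derivative_add has_derivative_pd d)
    finally show ?thesis .
  qed
  moreover have "pd s (\<lambda>p. B p (c *\<^sub>R a) b) q = c *\<^sub>R pd s (\<lambda>p. B p a b) q" for a b c
  proof -
    have "pd s (\<lambda>p. B p (c *\<^sub>R a) b) q = pd s (\<lambda>p. c *\<^sub>R B p a b) q"
      by (rule pd_cong_open[OF assms(1,2)]) (simp add: assms(3) bilinear_lmul)
    also have "\<dots> = c *\<^sub>R pd s (\<lambda>p. B p a b) q"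
      by (rule pd_eqI) (intro has_derivative_scaleR_right has_derivative_pd d)
    finally show ?thesis .
  qed
  moreover have "pd s (\<lambda>p. B p a (c *\<^sub>R b)) q = c *\<^sub>R pd s (\<lambda>p. B p a b) q" for a b c
  proof -
    have "pd s (\<lambda>p. B p a (c *\<^sub>R b)) q = pd s (\<lambda>p. c *\<^sub>R B p a b) q"
      by (rule pd_cong_open[OF assms(1,2)]) (simp add: assms(3) bilinear_rmul)
    also have "\<dots> = c *\<^sub>R pd s (\<lambda>p. B p a b) q"
      by (rule pd_eqI) (intro has_derivative_scaleR_right has_derivative_pd d)
    finally show ?thesis .
  qed
  ultimately show ?thesis unfolding bilinear_def by (simp add: linear_iff)
qed

text \<open>A product rule with three factors. Expanding both arguments in the standard basis leaves
  finitely many products of differentiable functions of \<open>q\<close>, so differentiability of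
  \<open>B p a b\<close> in \<open>p\<close> for fixed \<open>a\<close> and \<open>b\<close> is
  enough.\<close>

lemma has_derivative_bilinear_family:
  fixes B :: "'p::real_normed_vector \<Rightarrow> 'a::euclidean_space \<Rightarrow> 'a \<Rightarrow> 'c::real_normed_vector"
    and \<psi> :: "'q::real_normed_vector \<Rightarrow> 'p"
  assumes "open S" "\<psi> q \<in> S" and bil: "\<And>p. p \<in> S \<Longrightarrow> bilinear (B p)"
    and d: "\<And>a b. (\<lambda>p. B p a b) differentiable (at (\<psi> q))"
    and d\<psi>: "(\<psi> has_derivative \<psi>') (at q)"
    and dV: "(V has_derivative V') (at q)" and dW: "(W has_derivative W') (at q)"
  shows "((\<lambda>q. B (\<psi> q) (V q) (W q)) has_derivative
    (\<lambda>s. pd (\<psi>' s) (\<lambda>p. B p (V q) (W q)) (\<psi> q) + B (\<psi> q) (V' s) (W q) + B (\<psi> q) (V q) (W' s))) (at q)"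
proof -
  \<comment> \<open>The basis expansion holds only where \<open>B (\<psi> x)\<close> is bilinear,
    hence only near \<open>q\<close>.\<close>
  have ev: "\<forall>\<^sub>F x in at q. \<psi> x \<in> S"
    using has_derivative_continuous[OF d\<psi>] assms(1,2) unfolding continuous_within
    by (simp add: topological_tendstoD)
  have dB: "((\<lambda>x. B (\<psi> x) i j) has_derivative (\<lambda>s. pd (\<psi>' s) (\<lambda>p. B p i j) (\<psi> q))) (at q)" for i j
    using has_derivative_compose[OF d\<psi> has_derivative_pd[OF d]] .
  have "((\<lambda>x. \<Sum>i\<in>Basis. \<Sum>j\<in>Basis. ((V x \<bullet> i) * (W x \<bullet> j)) *\<^sub>R B (\<psi> x) i j) has_derivative
     (\<lambda>s. \<Sum>i\<in>Basis. \<Sum>j\<in>Basis. ((V q \<bullet> i) * (W q \<bullet> j)) *\<^sub>R pd (\<psi>' s) (\<lambda>p. B p i j) (\<psi> q) +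
        ((V q \<bullet> i) * (W' s \<bullet> j) + (V' s \<bullet> i) * (W q \<bullet> j)) *\<^sub>R B (\<psi> q) i j)) (at q)"
    by (intro has_derivative_sum has_derivative_scaleR has_derivative_mult has_derivative_inner_left dV dW dB)
  also have "(\<lambda>s. \<Sum>i\<in>Basis. \<Sum>j\<in>Basis. ((V q \<bullet> i) * (W q \<bullet> j)) *\<^sub>R pd (\<psi>' s) (\<lambda>p. B p i j) (\<psi> q) +
        ((V q \<bullet> i) * (W' s \<bullet> j) + (V' s \<bullet> i) * (W q \<bullet> j)) *\<^sub>R B (\<psi> q) i j) =
     (\<lambda>s. pd (\<psi>' s) (\<lambda>p. B p (V q) (W q)) (\<psi> q) + B (\<psi> q) (V' s) (W q) + B (\<psi> q) (V q) (W' s))"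
  proof
    fix s
    have pb: "bilinear (\<lambda>a b. pd (\<psi>' s) (\<lambda>p. B p a b) (\<psi> q))"
      by (rule pd_bilinear[OF assms(1,2) bil d])
    show "(\<Sum>i\<in>Basis. \<Sum>j\<in>Basis. ((V q \<bullet> i) * (W q \<bullet> j)) *\<^sub>R pd (\<psi>' s) (\<lambda>p. B p i j) (\<psi> q) +
        ((V q \<bullet> i) * (W' s \<bullet> j) + (V' s \<bullet> i) * (W q \<bullet> j)) *\<^sub>R B (\<psi> q) i j) =
     pd (\<psi>' s) (\<lambda>p. B p (V q) (W q)) (\<psi> q) + B (\<psi> q) (V' s) (W q) + B (\<psi> q) (V q) (W' s)"
      unfolding bilinear_Basis_expand[OF bil[OF assms(2)], of "V' s"]
        bilinear_Basis_expand[OF bil[OF assms(2)], of "V q" "W' s"]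
        bilinear_Basis_expand[OF pb, of "V q" "W q"]
      by (simp add: sum.distrib[symmetric] algebra_simps scaleR_add_left)
  qed
  finally have *: "((\<lambda>x. \<Sum>i\<in>Basis. \<Sum>j\<in>Basis. ((V x \<bullet> i) * (W x \<bullet> j)) *\<^sub>R B (\<psi> x) i j) has_derivative
     (\<lambda>s. pd (\<psi>' s) (\<lambda>p. B p (V q) (W q)) (\<psi> q) + B (\<psi> q) (V' s) (W q) + B (\<psi> q) (V q) (W' s))) (at q)" .
  show ?thesis
    by (rule has_derivative_transform_eventually[OF *])
      (use ev assms(2) in \<open>auto elim!: eventually_mono simp: bilinear_Basis_expand[OF bil, symmetric]\<close>)
qed

section \<open>The Levi-Civita connection in a chart\<close>

text \<open>\<open>G v\<close> represents \<open>B v\<close> with respect to the Euclidean inner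
  product. Positivity makes the linear map \<open>G\<close> injective, hence surjective in finite
  dimension.\<close>

lemma riesz_representation_ex1:
  fixes B :: "'a::euclidean_space \<Rightarrow> 'a \<Rightarrow> real"
  assumes bil: "bilinear B" and pos: "\<And>a. a \<noteq> 0 \<Longrightarrow> B a a > 0" and "linear k"
  shows "\<exists>!v. \<forall>c. B v c = k c"
proof -
  define G where "G v = (\<Sum>e\<in>Basis. B v e *\<^sub>R e)" for v
  have rep: "f c = (\<Sum>e\<in>Basis. f e *\<^sub>R e) \<bullet> c" if "linear f" for f :: "'a \<Rightarrow> real" and c
  proof -
    have "f c = f (\<Sum>e\<in>Basis. (c \<bullet> e) *\<^sub>R e)" by (simp add: euclidean_representation)
    also have "\<dots> = (\<Sum>e\<in>Basis. (c \<bullet> e) * f e)" using that by (simp add: linear_sum linear_scale)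
    finally show ?thesis by (simp add: inner_sum_left inner_commute[of c] mult.commute)
  qed
  have BG: "B v c = G v \<bullet> c" for v c
    unfolding G_def by (rule rep) (use bil in \<open>simp add: bilinear_def\<close>)
  have linG: "linear G"
    unfolding G_def using bil by (auto intro!: linearI simp: bilinear_ladd bilinear_lmul
      scaleR_add_left sum.distrib scaleR_sum_right)
  have "inj G"
  proof (rule linear_injective_0[THEN iffD2, OF linG, rule_format])
    fix v assume "G v = 0"
    then show "v = 0" using BG[of v v] pos[of v] by fastforce
  qed
  then obtain v where "G v = (\<Sum>e\<in>Basis. k e *\<^sub>R e)"
    using linear_injective_imp_surjective[OF linG] by (metis surjD)
  then have v: "B v c = k c" for c using rep[OF \<open>linear k\<close>] BG by metis
  moreover have "w = v" if "\<forall>c. B w c = k c" for w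
  proof -
    have "B (w - v) (w - v) = 0" using that v by (simp add: bilinear_lsub[OF bil])
    then show ?thesis using pos[of "w - v"] by auto
  qed
  ultimately show ?thesis by (intro ex1I[of _ v]) auto
qed

text \<open>The solution of \<open>B p (v p) = k p\<close> is read off the inverse of \<open>(p, v) \<mapsto> (p, B p v)\<close>, so the
  inverse function theorem makes it differentiable.\<close>

lemma differentiable_riesz:
  fixes B :: "'p::euclidean_space \<Rightarrow> 'a::euclidean_space \<Rightarrow> 'a \<Rightarrow> real"
  assumes "open S" "q \<in> S" and bil: "\<And>p. p \<in> S \<Longrightarrow> bilinear (B p)"
    and pos: "\<And>p a. p \<in> S \<Longrightarrow> a \<noteq> 0 \<Longrightarrow> B p a a > 0"
    and dB: "\<And>p a b. p \<in> S \<Longrightarrow> (\<lambda>p. B p a b) differentiable (at p)"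
    and v: "\<And>p c. p \<in> S \<Longrightarrow> B p (v p) c = k p c"
    and dk: "\<And>c. (\<lambda>p. k p c) differentiable (at q)"
  shows "v differentiable (at q)"
proof -
  define G where "G p a = (\<Sum>e\<in>Basis. B p a e *\<^sub>R e)" for p a
  have GB: "G p a \<bullet> e = B p a e" if "e \<in> Basis" for p a e
    unfolding G_def using that by (simp add: inner_sum_left_Basis)
  have inner_eq: "f c = g c"
    if "linear f" "linear g" "\<And>e. e \<in> Basis \<Longrightarrow> f e = g e" for f g :: "'a \<Rightarrow> real" and c
    using linear_eq_stdbasis[OF that(1,2)] that(3) by metis
  have uniq: "a = b" if "p \<in> S" "G p a = G p b" for p a b
  proof -
    have "B p a c = B p b c" for c
    proof (rule inner_eq)
      show "linear (B p a)" "linear (B p b)" using bil[OF that(1)] by (simp_all add: bilinear_def)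
      show "B p a e = B p b e" if "e \<in> Basis" for e
        using GB[OF that] \<open>G p a = G p b\<close> by metis
    qed
    then have "B p (a - b) (a - b) = 0" by (simp add: bilinear_lsub[OF bil[OF that(1)]])
    then show ?thesis using pos[OF that(1), of "a - b"] by auto
  qed
  have dG: "((\<lambda>x. G (fst x) (snd x)) has_derivative
      (\<lambda>s. \<Sum>e\<in>Basis. (pd (fst s) (\<lambda>p. B p (snd z) e) (fst z) + B (fst z) (snd s) e) *\<^sub>R e)) (at z)"
    if "fst z \<in> S" for z
  proof -
    have "((\<lambda>x. B (fst x) (snd x) e) has_derivative
      (\<lambda>s. pd (fst s) (\<lambda>p. B p (snd z) e) (fst z) + B (fst z) (snd s) e + B (fst z) (snd z) 0)) (at z)" for e
      using that
      by (intro has_derivative_bilinear_family[OF \<open>open S\<close>] bil dB) (auto intro!: derivative_eq_intros)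
    then show ?thesis unfolding G_def using bil[OF that]
      by (intro has_derivative_sum has_derivative_scaleR_left) (simp add: bilinear_rzero)
  qed
  define f where "f x = (fst x, G (fst x) (snd x))" for x
  define f' where "f' z s = (fst s, \<Sum>e\<in>Basis. (pd (fst s) (\<lambda>p. B p (snd z) e) (fst z) + B (fst z) (snd s) e) *\<^sub>R e)" for z s
  have df: "(f has_derivative f' z) (at z)" if "fst z \<in> S" for z
    unfolding f_def f'_def by (intro has_derivative_Pair dG that) (auto intro: derivative_eq_intros)
  define g where "g = (\<lambda>y. (fst y, inv (G (fst y)) (snd y)))"
  have "\<exists>w. G q w = y" for y
  proof -
    have "linear (\<lambda>c. y \<bullet> c)" by (simp add: linear_iff inner_right_distrib)
    from ex1_implies_ex[OF riesz_representation_ex1[OF bil[OF \<open>q \<in> S\<close>] pos[OF \<open>q \<in> S\<close>] this]]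
    obtain w where w: "\<And>c. B q w c = y \<bullet> c" by auto
    have "G q w = y" unfolding G_def w by (simp add: euclidean_representation)
    then show ?thesis by blast
  qed
  then obtain Gi where Gi: "\<And>y. G q (Gi y) = y" by metis
  \<comment> \<open>The derivative of \<open>f\<close> at \<open>(q, v q)\<close> is block
    triangular with the identity as first block, so a right inverse needs only preimages under
    \<open>G q\<close>.\<close>
  define g' where "g' s = (fst s, Gi (snd s - (\<Sum>e\<in>Basis. pd (fst s) (\<lambda>p. B p (v q) e) q *\<^sub>R e)))" for s
  have "f' (q, v q) (g' s) = s" for s
  proof -
    have "(\<Sum>e\<in>Basis. B q (snd (g' s)) e *\<^sub>R e) = snd s - (\<Sum>e\<in>Basis. pd (fst s) (\<lambda>p. B p (v q) e) q *\<^sub>R e)"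
      using Gi[of "snd s - (\<Sum>e\<in>Basis. pd (fst s) (\<lambda>p. B p (v q) e) q *\<^sub>R e)"] unfolding g'_def G_def by simp
    then show ?thesis unfolding f'_def by (simp add: scaleR_add_left sum.distrib) (simp add: g'_def)
  qed
  then have inv': "f' (q, v q) \<circ> g' = id" by auto
  have "(g has_derivative g') (at (f (q, v q)))"
  proof (rule has_derivative_inverse_strong[where f = f and x = "(q, v q)" and f' = "f' (q, v q)"])
    show "open (S \<times> (UNIV :: 'a set))" using \<open>open S\<close> by (simp add: open_Times)
    show "(q, v q) \<in> S \<times> UNIV" using assms by simp
    show "continuous_on (S \<times> UNIV) f"
      using df has_derivative_continuous continuous_at_imp_continuous_on by (metis mem_Times_iff)
    show "g (f x) = x" if "x \<in> S \<times> UNIV" for x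
    proof -
      have "inj (G (fst x))" using uniq that by (auto intro: injI)
      then show ?thesis unfolding g_def f_def by simp
    qed
    show "(f has_derivative f' (q, v q)) (at (q, v q))" using df assms by simp
    show "f' (q, v q) \<circ> g' = id" by (rule inv')
  qed
  then have g: "g differentiable (at (q, G q (v q)))" unfolding f_def differentiable_def by auto
  have Gv: "G p (v p) = (\<Sum>e\<in>Basis. k p e *\<^sub>R e)" if "p \<in> S" for p
    unfolding G_def using v[OF that] by simp
  \<comment> \<open>On \<open>S\<close> this is \<open>f (p, v p)\<close>, but written in terms of
    \<open>k\<close> alone; hence \<open>v\<close> is the second component of \<open>g\<close> after
    \<open>F\<close>.\<close>
  define F where "F p = (p, \<Sum>e\<in>Basis. k p e *\<^sub>R e)" for p
  have "(F has_derivative (\<lambda>s. (s, \<Sum>e\<in>Basis. pd s (\<lambda>p. k p e) q *\<^sub>R e))) (at q)"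
    unfolding F_def
    by (intro has_derivative_Pair has_derivative_sum has_derivative_scaleR_left has_derivative_pd dk has_derivative_ident)
  then have "F differentiable (at q)" unfolding differentiable_def by blast
  moreover have "g differentiable (at (F q))" using g Gv[OF \<open>q \<in> S\<close>] by (simp add: F_def)
  ultimately have "(\<lambda>p. g (F p)) differentiable (at q)" using differentiable_chain_at[of F q g]
    by (simp add: o_def)
  then have "(\<lambda>p. snd (g (F p))) differentiable (at q)"
    unfolding differentiable_def using has_derivative_snd by blast
  then show ?thesis
  proof (rule differentiable_cong_open[OF assms(1,2), rotated])
    fix p assume p: "p \<in> S"
    have "inj (G p)" using uniq p by (auto intro: injI)
    then show "snd (g (F p)) = v p" unfolding g_def F_def using Gv[OF p] by (metis fst_conv inv_f_f snd_conv)
  qed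
qed

locale chart_metric =
  fixes U :: "'e::euclidean_space set" and h :: "'e \<Rightarrow> 'e \<Rightarrow> 'e \<Rightarrow> real"
  assumes openU: "open U"
    and bil: "\<And>p. p \<in> U \<Longrightarrow> bilinear (h p)"
    and h_sym: "\<And>p a b. p \<in> U \<Longrightarrow> h p a b = h p b a"
    and pos: "\<And>p a. p \<in> U \<Longrightarrow> a \<noteq> 0 \<Longrightarrow> h p a a > 0"
    and smooth: "\<And>a b. smooth_on U (\<lambda>p. h p a b)"
begin

abbreviation "\<Gamma> \<equiv> christoffel h"

lemma diff_h: "p \<in> U \<Longrightarrow> (\<lambda>p. h p a b) differentiable (at p)"
  using smooth smooth_on_differentiable by blast

lemma diff_pd_h: "p \<in> U \<Longrightarrow> pd s (\<lambda>p. h p a b) differentiable (at p)"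
  using smooth smooth_on_pd smooth_on_differentiable by blast

lemma bilinear_pd_h: "p \<in> U \<Longrightarrow> bilinear (\<lambda>a b. pd s (\<lambda>p. h p a b) p)"
  by (rule pd_bilinear[OF openU _ bil diff_h])

lemma pd_h_sym: "p \<in> U \<Longrightarrow> pd s (\<lambda>p. h p a b) p = pd s (\<lambda>p. h p b a) p"
  by (rule pd_cong_open[OF openU]) (auto intro: h_sym)

definition koszul :: "'e \<Rightarrow> 'e \<Rightarrow> 'e \<Rightarrow> 'e \<Rightarrow> real" where
  "koszul q a b c = pd a (\<lambda>p. h p b c) q + pd b (\<lambda>p. h p a c) q - pd c (\<lambda>p. h p a b) q"

lemma koszul_add:
  assumes q: "q \<in> U"
  shows "koszul q (a + a') b c = koszul q a b c + koszul q a' b c"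
    "koszul q a (b + b') c = koszul q a b c + koszul q a b' c"
    "koszul q a b (c + c') = koszul q a b c + koszul q a b c'"
  unfolding koszul_def using bilinear_pd_h[OF q] linear_pd[OF diff_h[OF q]]
  by (simp_all add: bilinear_def linear_iff)

lemma koszul_scale:
  assumes q: "q \<in> U"
  shows "koszul q (r *\<^sub>R a) b c = r * koszul q a b c"
    "koszul q a (r *\<^sub>R b) c = r * koszul q a b c"
    "koszul q a b (r *\<^sub>R c) = r * koszul q a b c"
  unfolding koszul_def using bilinear_pd_h[OF q] linear_pd[OF diff_h[OF q]]
  by (simp_all add: bilinear_def linear_iff algebra_simps)

text \<open>Unique solvability of the Koszul equation removes the description operator from
  \<open>christoffel\<close>. The properties of \<open>\<Gamma>\<close> below are read off this
  identity.\<close>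

lemma h_christoffel:
  assumes q: "q \<in> U"
  shows "2 * h q (\<Gamma> q a b) c = koszul q a b c"
proof -
  have "linear (\<lambda>c. koszul q a b c / 2)"
    by (rule linearI) (simp_all add: koszul_add[OF q] koszul_scale[OF q] add_divide_distrib)
  from riesz_representation_ex1[OF bil[OF q] pos[OF q] this]
  have "\<exists>!v. \<forall>c. 2 * h q v c = koszul q a b c" by (simp add: field_simps)
  from theI'[OF this] show ?thesis unfolding christoffel_def koszul_def by blast
qed

lemma h_eqI:
  assumes q: "q \<in> U" and "\<And>c. h q v c = h q w c"
  shows "v = w"
proof -
  have "h q (v - w) (v - w) = 0" using assms(2) by (simp add: bilinear_lsub[OF bil[OF q]])
  then show ?thesis using pos[OF q, of "v - w"] by auto
qed

lemma christoffel_sym: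
  assumes q: "q \<in> U" shows "\<Gamma> q a b = \<Gamma> q b a"
proof (rule h_eqI[OF q])
  have "koszul q a b c = koszul q b a c" for c
    unfolding koszul_def using pd_h_sym[OF q] by simp
  then show "h q (\<Gamma> q a b) c = h q (\<Gamma> q b a) c" for c
    using h_christoffel[OF q] by (metis mult_cancel_left zero_neq_numeral)
qed

lemma bilinear_christoffel:
  assumes q: "q \<in> U" shows "bilinear (\<Gamma> q)"
proof -
  have "\<Gamma> q (a + a') b = \<Gamma> q a b + \<Gamma> q a' b" for a a' b
  proof (rule h_eqI[OF q])
    fix c show "h q (\<Gamma> q (a + a') b) c = h q (\<Gamma> q a b + \<Gamma> q a' b) c"
      using h_christoffel[OF q, of "a + a'" b c] h_christoffel[OF q, of a b c]
        h_christoffel[OF q, of a' b c] koszul_add(1)[OF q, of a a' b c]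
      by (simp add: bilinear_ladd[OF bil[OF q]])
  qed
  moreover have "\<Gamma> q (r *\<^sub>R a) b = r *\<^sub>R \<Gamma> q a b" for r a b
  proof (rule h_eqI[OF q])
    fix c
    have "2 * h q (\<Gamma> q (r *\<^sub>R a) b) c = r * (2 * h q (\<Gamma> q a b) c)"
      unfolding h_christoffel[OF q] by (rule koszul_scale(1)[OF q])
    then show "h q (\<Gamma> q (r *\<^sub>R a) b) c = h q (r *\<^sub>R \<Gamma> q a b) c"
      by (simp add: bilinear_lmul[OF bil[OF q]])
  qed
  ultimately have lin: "linear (\<lambda>a. \<Gamma> q a b)" for b by (intro linearI)
  moreover have "\<Gamma> q a = (\<lambda>b. \<Gamma> q b a)" for a using christoffel_sym[OF q] by blast
  ultimately show ?thesis unfolding bilinear_def by metis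
qed

text \<open>\<open>\<Gamma>\<close> solves a linear equation whose coefficients are the metric and
  whose right side consists of its first derivatives, all of them differentiable.\<close>

lemma diff_christoffel:
  assumes q: "q \<in> U" shows "(\<lambda>p. \<Gamma> p a b) differentiable (at q)"
proof (rule differentiable_riesz[OF openU q bil pos diff_h, where k = "\<lambda>p c. koszul p a b c / 2"])
  show "(\<lambda>p. koszul p a b c / 2) differentiable (at q)" for c
    unfolding koszul_def
    by (intro differentiable_divide differentiable_add differentiable_diff diff_pd_h q) auto
  show "h p (\<Gamma> p a b) c = koszul p a b c / 2" if "p \<in> U" for p c
    using h_christoffel[OF that] by (simp add: field_simps)
qed

text \<open>In the sum of the Koszul expressions for \<open>(s, a, b)\<close> and
  \<open>(s, b, a)\<close> everything cancels except twice the derivative along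
  \<open>s\<close>.\<close>

lemma metric_compatible:
  assumes q: "q \<in> U"
  shows "pd s (\<lambda>p. h p a b) q = h q (\<Gamma> q s a) b + h q a (\<Gamma> q s b)"
proof -
  have "2 * pd s (\<lambda>p. h p a b) q = koszul q s a b + koszul q s b a"
    unfolding koszul_def using pd_h_sym[OF q] by simp
  then show ?thesis
    using h_christoffel[OF q, of s a b] h_christoffel[OF q, of s b a] h_sym[OF q, of a "\<Gamma> q s b"] by simp
qed

lemma cov_deriv_const: "cov_deriv h (\<lambda>_. x) (\<lambda>_. y) = (\<lambda>p. \<Gamma> p x y)"
  unfolding cov_deriv_def by (simp add: frechet_derivative_const)

lemma curvature_operator_const:
  assumes q: "q \<in> U"
  shows "curvature_operator h (\<lambda>_. x) (\<lambda>_. y) (\<lambda>_. z) q =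
    pd x (\<lambda>p. \<Gamma> p y z) q + \<Gamma> q x (\<Gamma> q y z) - (pd y (\<lambda>p. \<Gamma> p x z) q + \<Gamma> q y (\<Gamma> q x z))"
proof -
  have "lie_bracket (\<lambda>_. x) (\<lambda>_. y) = (\<lambda>_. 0)"
    unfolding lie_bracket_def by (simp add: frechet_derivative_const)
  then show ?thesis unfolding curvature_operator_def cov_deriv_const
    using bilinear_lzero[OF bilinear_christoffel[OF q]] by (simp add: cov_deriv_def)
qed

end

section \<open>Curvature in a moving coordinate frame\<close>

text \<open>\<open>\<psi>\<close> is a change from coordinates on \<open>W\<close> to the chart with
  range \<open>U\<close>. Vector fields are taken along \<open>\<psi>\<close>, as functions on
  \<open>W\<close> whose values are components in the chart, so that no inverse of
  \<open>\<psi>\<close> enters.\<close>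

locale chart_frame = chart_metric U h for U :: "'e::euclidean_space set" and h +
  fixes W :: "'e set" and \<psi> :: "'e \<Rightarrow> 'e"
  assumes openW: "open W" and \<psi>U: "\<And>q. q \<in> W \<Longrightarrow> \<psi> q \<in> U" and smooth\<psi>: "smooth_on W \<psi>"
begin

abbreviation X :: "'e \<Rightarrow> 'e \<Rightarrow> 'e" where "X a \<equiv> pd a \<psi>"

text \<open>The Levi-Civita connection pulled back along \<open>\<psi>\<close>: the covariant
  derivative of \<open>V\<close> in the coordinate direction \<open>a\<close> of
  \<open>W\<close>.\<close>

definition nabla :: "('e \<Rightarrow> 'e) \<Rightarrow> 'e \<Rightarrow> 'e \<Rightarrow> 'e" where
  "nabla V a q = pd a V q + \<Gamma> (\<psi> q) (X a q) (V q)"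

text \<open>The pullback metric, that is, the coefficients of the metric in the coordinates of
  \<open>W\<close>.\<close>

definition H :: "'e \<Rightarrow> 'e \<Rightarrow> 'e \<Rightarrow> real" where
  "H a b q = h (\<psi> q) (X a q) (X b q)"

lemma diff_\<psi>: "q \<in> W \<Longrightarrow> \<psi> differentiable (at q)"
  using smooth\<psi> smooth_on_differentiable by blast

lemma diff_X: "q \<in> W \<Longrightarrow> X a differentiable (at q)"
  using smooth\<psi> smooth_on_pd smooth_on_differentiable by blast

lemma diff_pd_X: "q \<in> W \<Longrightarrow> pd b (X a) differentiable (at q)"
  using smooth\<psi> smooth_on_pd smooth_on_differentiable by blast

lemma pd_X_sym: "q \<in> W \<Longrightarrow> pd a (X b) q = pd b (X a) q"
  by (rule second_derivative_symmetric[OF openW]) (auto intro: diff_\<psi> diff_X)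

lemma pd_pd_X_sym: "q \<in> W \<Longrightarrow> pd a (pd b (X c)) q = pd b (pd a (X c)) q"
  by (rule second_derivative_symmetric[OF openW]) (auto intro: diff_X diff_pd_X)

text \<open>Vanishing torsion for commuting coordinate fields: mixed partial derivatives of
  \<open>\<psi>\<close> agree and \<open>\<Gamma>\<close> is symmetric.\<close>

lemma nabla_sym: "q \<in> W \<Longrightarrow> nabla (X b) a q = nabla (X a) b q"
  unfolding nabla_def using pd_X_sym christoffel_sym[OF \<psi>U] by metis

lemma has_derivative_christoffel:
  assumes q: "q \<in> W" and V: "V differentiable (at q)" "Z differentiable (at q)"
  shows "((\<lambda>q. \<Gamma> (\<psi> q) (V q) (Z q)) has_derivative
    (\<lambda>s. pd (X s q) (\<lambda>p. \<Gamma> p (V q) (Z q)) (\<psi> q) + \<Gamma> (\<psi> q) (pd s V q) (Z q)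
      + \<Gamma> (\<psi> q) (V q) (pd s Z q))) (at q)"
  by (rule has_derivative_bilinear_family[OF openU \<psi>U[OF q] bilinear_christoffel
      diff_christoffel[OF \<psi>U[OF q]] has_derivative_pd[OF diff_\<psi>[OF q]]
      has_derivative_pd[OF V(1)] has_derivative_pd[OF V(2)]])

text \<open>By metric compatibility, the derivative of \<open>h\<close> at fixed arguments supplies
  exactly the Christoffel terms that complete the partial derivatives of \<open>V\<close> and
  \<open>Z\<close> to \<open>nabla\<close>.\<close>

lemma has_derivative_h:
  assumes q: "q \<in> W" and V: "V differentiable (at q)" "Z differentiable (at q)"
  shows "((\<lambda>q. h (\<psi> q) (V q) (Z q)) has_derivative
    (\<lambda>s. h (\<psi> q) (nabla V s q) (Z q) + h (\<psi> q) (V q) (nabla Z s q))) (at q)"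
proof -
  have "((\<lambda>q. h (\<psi> q) (V q) (Z q)) has_derivative
    (\<lambda>s. pd (X s q) (\<lambda>p. h p (V q) (Z q)) (\<psi> q) + h (\<psi> q) (pd s V q) (Z q)
      + h (\<psi> q) (V q) (pd s Z q))) (at q)"
    by (rule has_derivative_bilinear_family[OF openU \<psi>U[OF q] bil
      diff_h[OF \<psi>U[OF q]] has_derivative_pd[OF diff_\<psi>[OF q]]
      has_derivative_pd[OF V(1)] has_derivative_pd[OF V(2)]])
  then show ?thesis
    by (rule has_derivative_eq_rhs) (auto simp: nabla_def metric_compatible[OF \<psi>U[OF q]]
      bilinear_ladd[OF bil[OF \<psi>U[OF q]]] bilinear_radd[OF bil[OF \<psi>U[OF q]]])
qed

lemma diff_nabla_X: "q \<in> W \<Longrightarrow> nabla (X b) a differentiable (at q)"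
  unfolding nabla_def
  by (intro differentiable_add diff_pd_X differentiableI[OF has_derivative_christoffel] diff_X)

lemma has_derivative_H:
  "q \<in> W \<Longrightarrow> (H a b has_derivative
    (\<lambda>s. h (\<psi> q) (nabla (X a) s q) (X b q) + h (\<psi> q) (X a q) (nabla (X b) s q))) (at q)"
  unfolding H_def[abs_def] by (rule has_derivative_h) (auto intro: diff_X)

lemma pd_H:
  "q \<in> W \<Longrightarrow> pd s (H a b) q = h (\<psi> q) (nabla (X a) s q) (X b q) + h (\<psi> q) (X a q) (nabla (X b) s q)"
  by (rule pd_eqI[OF has_derivative_H])

lemma diff_H: "q \<in> W \<Longrightarrow> H a b differentiable (at q)"
  by (rule differentiableI[OF has_derivative_H])

lemma diff_pd_H:
  assumes q: "q \<in> W"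
  shows "pd s (H a b) differentiable (at q)"
proof (rule differentiable_cong_open[OF openW q])
  show "(\<lambda>q. h (\<psi> q) (nabla (X a) s q) (X b q) + h (\<psi> q) (X a q) (nabla (X b) s q)) differentiable (at q)"
    by (intro differentiable_add differentiableI[OF has_derivative_h] diff_X diff_nabla_X q)
qed (simp add: pd_H)

lemma pd_pd_H_sym: "q \<in> W \<Longrightarrow> pd a (pd b (H c d)) q = pd b (pd a (H c d)) q"
  by (rule second_derivative_symmetric[OF openW]) (auto intro: diff_H diff_pd_H)

text \<open>Metric compatibility expands the three derivatives into six terms; torsion-freeness
  cancels four of them and identifies the other two.\<close>

lemma koszul_H:
  assumes q: "q \<in> W"
  shows "2 * h (\<psi> q) (nabla (X b) a q) (X c q) = pd a (H b c) q + pd b (H a c) q - pd c (H a b) q"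
  unfolding pd_H[OF q] nabla_sym[OF q, of c a] nabla_sym[OF q, of c b] nabla_sym[OF q, of b a]
  using h_sym[OF \<psi>U[OF q]] by simp

text \<open>This is the required instance of tensoriality. The derivatives of the frame cancel by
  symmetry of mixed partials, leaving the curvature of the constant extensions of the frame vectors
  at the point, which is what \<open>riemann_tensor\<close> evaluates.\<close>

lemma nabla_commutator:
  assumes q: "q \<in> W"
  shows "nabla (nabla (X c) b) a q - nabla (nabla (X c) a) b q =
    curvature_operator h (\<lambda>_. X a q) (\<lambda>_. X b q) (\<lambda>_. X c q) (\<psi> q)"
proof -
  have "nabla (nabla (X c) b) a q = pd a (pd b (X c)) q +
      (pd (X a q) (\<lambda>p. \<Gamma> p (X b q) (X c q)) (\<psi> q) + \<Gamma> (\<psi> q) (pd a (X b) q) (X c q)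
      + \<Gamma> (\<psi> q) (X b q) (pd a (X c) q)) +
      (\<Gamma> (\<psi> q) (X a q) (pd b (X c) q) + \<Gamma> (\<psi> q) (X a q) (\<Gamma> (\<psi> q) (X b q) (X c q)))" for a b
  proof -
    have "pd a (nabla (X c) b) q = pd a (pd b (X c)) q +
      (pd (X a q) (\<lambda>p. \<Gamma> p (X b q) (X c q)) (\<psi> q) + \<Gamma> (\<psi> q) (pd a (X b) q) (X c q)
      + \<Gamma> (\<psi> q) (X b q) (pd a (X c) q))"
      unfolding nabla_def[abs_def]
      by (rule pd_eqI) (intro has_derivative_add has_derivative_christoffel has_derivative_pd diff_pd_X diff_X q)
    moreover have "\<Gamma> (\<psi> q) (X a q) (nabla (X c) b q) =
       \<Gamma> (\<psi> q) (X a q) (pd b (X c) q) + \<Gamma> (\<psi> q) (X a q) (\<Gamma> (\<psi> q) (X b q) (X c q))"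
      unfolding nabla_def by (rule bilinear_radd[OF bilinear_christoffel[OF \<psi>U[OF q]]])
    ultimately show ?thesis by (subst nabla_def) simp
  qed
  then show ?thesis
    unfolding curvature_operator_const[OF \<psi>U[OF q]]
    using pd_pd_X_sym[OF q, where a = a and b = b and c = c] pd_X_sym[OF q, where a = a and b = b] by simp
qed

definition Riem :: "'e \<Rightarrow> 'e \<Rightarrow> 'e \<Rightarrow> 'e \<Rightarrow> 'e \<Rightarrow> real" where
  "Riem q a b c d =
    h (\<psi> q) (curvature_operator h (\<lambda>_. X a q) (\<lambda>_. X b q) (\<lambda>_. X c q) (\<psi> q)) (X d q)"

text \<open>The Koszul formula for the pairing of \<open>nabla (X c) b\<close> with
  \<open>X d\<close> is differentiated along \<open>a\<close> and antisymmetrized in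
  \<open>a\<close> and \<open>b\<close>. The term \<open>pd a (pd b (H c d))\<close> then drops out
  by symmetry.\<close>

lemma Riem_eq:
  assumes q: "q \<in> W"
  shows "2 * Riem q a b c d =
    pd a (pd c (H b d)) q - pd a (pd d (H b c)) q - pd b (pd c (H a d)) q + pd b (pd d (H a c)) q
    + 2 * h (\<psi> q) (nabla (X a) c q) (nabla (X b) d q)
    - 2 * h (\<psi> q) (nabla (X b) c q) (nabla (X a) d q)"
proof -
  have *: "2 * (h (\<psi> q) (nabla (nabla (X c) b) a q) (X d q) + h (\<psi> q) (nabla (X c) b q) (nabla (X d) a q)) =
    pd a (pd b (H c d)) q + pd a (pd c (H b d)) q - pd a (pd d (H b c)) q" for a b
  proof -
    have "((\<lambda>q. 2 * h (\<psi> q) (nabla (X c) b q) (X d q)) has_derivative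
        (\<lambda>a. 2 * (h (\<psi> q) (nabla (nabla (X c) b) a q) (X d q) + h (\<psi> q) (nabla (X c) b q) (nabla (X d) a q)))) (at q)"
      by (intro has_derivative_mult_right has_derivative_h diff_nabla_X diff_X q)
    from pd_eqI[OF this, of a]
    have "2 * (h (\<psi> q) (nabla (nabla (X c) b) a q) (X d q) + h (\<psi> q) (nabla (X c) b q) (nabla (X d) a q)) =
       pd a (\<lambda>q. 2 * h (\<psi> q) (nabla (X c) b q) (X d q)) q" by simp
    also have "\<dots> = pd a (\<lambda>q. pd b (H c d) q + pd c (H b d) q - pd d (H b c) q) q"
      by (rule pd_cong_open[OF openW q]) (rule koszul_H)
    also have "\<dots> = pd a (pd b (H c d)) q + pd a (pd c (H b d)) q - pd a (pd d (H b c)) q"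
      by (rule pd_eqI) (intro has_derivative_add has_derivative_diff has_derivative_pd diff_pd_H q)
    finally show ?thesis .
  qed
  have "Riem q a b c d =
      h (\<psi> q) (nabla (nabla (X c) b) a q) (X d q) - h (\<psi> q) (nabla (nabla (X c) a) b q) (X d q)"
    unfolding Riem_def nabla_commutator[OF q, symmetric] by (rule bilinear_lsub[OF bil[OF \<psi>U[OF q]]])
  then show ?thesis
    using *[of b a] *[of a b] pd_pd_H_sym[OF q, where a = a and b = b and c = c and d = d]
      nabla_sym[OF q, of a c] nabla_sym[OF q, of b c] nabla_sym[OF q, of a d] nabla_sym[OF q, of b d]
    by simp
qed

lemma linear_X: "q \<in> W \<Longrightarrow> linear (\<lambda>a. X a q)"
  by (rule linear_pd[OF diff_\<psi>])

lemma bilinear_H: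
  assumes q: "q \<in> W"
  shows "bilinear (\<lambda>a b. H a b q)"
  unfolding H_def bilinear_def using linear_X[OF q]
  by (simp add: linear_iff bilinear_ladd[OF bil[OF \<psi>U[OF q]]] bilinear_lmul[OF bil[OF \<psi>U[OF q]]]
    bilinear_radd[OF bil[OF \<psi>U[OF q]]] bilinear_rmul[OF bil[OF \<psi>U[OF q]]])

end

section \<open>The Gray identity in coordinates with constant complex structure\<close>

locale hermitian_frame = chart_frame U h W \<psi> for U :: "'e::euclidean_space set" and h W \<psi> +
  fixes J :: "'e \<Rightarrow> 'e"
  assumes J: "linear J" "\<And>a. J (J a) = - a" and HJ: "\<And>q a b. q \<in> W \<Longrightarrow> H (J a) (J b) q = H a b q"
    and surj_X: "\<And>q. q \<in> W \<Longrightarrow> surj (\<lambda>a. X a q)"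
begin

text \<open>Skew-adjointness of \<open>J\<close>. Its differentiated forms below serve as rewrite
  rules that move every \<open>J\<close> into the second slot of \<open>H\<close>, where two of them
  combine to a sign.\<close>

lemma H_J: "q \<in> W \<Longrightarrow> H (J a) b q = - H a (J b) q"
  using HJ[of q a "J b"] by (simp add: J bilinear_rneg[OF bilinear_H])

lemma pd_H_J: "q \<in> W \<Longrightarrow> pd s (H (J a) b) q = - pd s (H a (J b)) q"
proof -
  assume q: "q \<in> W"
  have "pd s (H (J a) b) q = pd s (\<lambda>p. - H a (J b) p) q"
    by (rule pd_cong_open[OF openW q H_J])
  also have "\<dots> = - pd s (H a (J b)) q"
    by (rule pd_eqI) (intro has_derivative_minus has_derivative_pd diff_H q)
  finally show ?thesis .
qed

lemma pd_pd_H_J: "q \<in> W \<Longrightarrow> pd r (pd s (H (J a) b)) q = - pd r (pd s (H a (J b))) q"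
proof -
  assume q: "q \<in> W"
  have "pd r (pd s (H (J a) b)) q = pd r (\<lambda>p. - pd s (H a (J b)) p) q"
    by (rule pd_cong_open[OF openW q pd_H_J])
  also have "\<dots> = - pd r (pd s (H a (J b))) q"
    by (rule pd_eqI) (intro has_derivative_minus has_derivative_pd diff_pd_H q)
  finally show ?thesis .
qed

lemma pd_H_neg: "q \<in> W \<Longrightarrow> pd s (H a (- b)) q = - pd s (H a b) q"
proof -
  assume q: "q \<in> W"
  have "pd s (H a (- b)) q = pd s (\<lambda>p. - H a b p) q"
    by (rule pd_cong_open[OF openW q bilinear_rneg[OF bilinear_H]])
  also have "\<dots> = - pd s (H a b) q"
    by (rule pd_eqI) (intro has_derivative_minus has_derivative_pd diff_H q)
  finally show ?thesis .
qed

lemma pd_pd_H_neg: "q \<in> W \<Longrightarrow> pd r (pd s (H a (- b))) q = - pd r (pd s (H a b)) q"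
proof -
  assume q: "q \<in> W"
  have "pd r (pd s (H a (- b))) q = pd r (\<lambda>p. - pd s (H a b) p) q"
    by (rule pd_cong_open[OF openW q pd_H_neg])
  also have "\<dots> = - pd r (pd s (H a b)) q"
    by (rule pd_eqI) (intro has_derivative_minus has_derivative_pd diff_pd_H q)
  finally show ?thesis .
qed

text \<open>Equivalently, the covariant derivative of the \<open>(1,0)\<close>-field \<open>X\<^sub>c - i X\<^bsub>Jc\<^esub>\<close> in the
  \<open>(1,0)\<close>-direction \<open>X\<^sub>a - i X\<^bsub>Ja\<^esub>\<close> is again of type \<open>(1,0)\<close>.\<close>

lemma nabla_J:
  assumes q: "q \<in> W"
  obtains s where "nabla (X a) c q - nabla (X (J a)) (J c) q = X s q"
    "nabla (X (J a)) c q + nabla (X a) (J c) q = X (J s) q"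
proof -
  obtain s where s: "nabla (X a) c q - nabla (X (J a)) (J c) q = X s q"
    using surj_X[OF q] by (metis surjD)
  note B = bil[OF \<psi>U[OF q]]
  have "nabla (X (J a)) c q + nabla (X a) (J c) q = X (J s) q"
  proof (rule h_eqI[OF \<psi>U[OF q]])
    \<comment> \<open>By surjectivity of the frame it is enough to pair with frame vectors, and
      there the Koszul formula evaluates every \<open>nabla\<close>.\<close>
    fix e' obtain e where e: "e' = X e q" using surj_X[OF q] by (metis surjD)
    have "h (\<psi> q) (X (J s) q) (X e q) = - h (\<psi> q) (X s q) (X (J e) q)"
      using H_J[OF q, of s e] by (simp add: H_def)
    also have "\<dots> = - (h (\<psi> q) (nabla (X a) c q) (X (J e) q) - h (\<psi> q) (nabla (X (J a)) (J c) q) (X (J e) q))"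
      by (simp add: bilinear_lsub[OF B] flip: s)
    also have "\<dots> = h (\<psi> q) (nabla (X (J a)) c q) (X e q) + h (\<psi> q) (nabla (X a) (J c) q) (X e q)"
      using koszul_H[OF q, of a c "J e"] koszul_H[OF q, of "J a" "J c" "J e"]
        koszul_H[OF q, of "J a" c e] koszul_H[OF q, of a "J c" e]
      by (simp add: pd_H_J[OF q] pd_H_neg[OF q] J)
    finally show "h (\<psi> q) (nabla (X (J a)) c q + nabla (X a) (J c) q) e' = h (\<psi> q) (X (J s) q) e'"
      by (simp add: e bilinear_ladd[OF B])
  qed
  with s that show ?thesis by blast
qed

theorem Riem_gray:
  assumes q: "q \<in> W"
  shows "Riem q x y z w + Riem q (J x) (J y) (J z) (J w) =
       Riem q (J x) (J y) z w + Riem q x y (J z) (J w) + Riem q (J x) y (J z) w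
       + Riem q x (J y) z (J w) + Riem q (J x) y z (J w) + Riem q x (J y) (J z) w"
proof -
  let ?g = "h (\<psi> q)" let ?N = "\<lambda>a c. nabla (X a) c q"
  note B = bil[OF \<psi>U[OF q]]
  \<comment> \<open>The expansion of
    \<open>\<langle>S, S'\<rangle> = \<langle>J S, J S'\<rangle>\<close>, with \<open>S\<close> and
    \<open>S'\<close> formed from the index pairs \<open>(a, c)\<close> and
    \<open>(b, d)\<close>.\<close>
  have quad: "?g (?N a c) (?N b d) + ?g (?N (J a) (J c)) (?N (J b) (J d))
      - ?g (?N (J a) (J c)) (?N b d) - ?g (?N a c) (?N (J b) (J d)) =
      ?g (?N (J a) c) (?N (J b) d) + ?g (?N a (J c)) (?N b (J d))
      + ?g (?N (J a) c) (?N b (J d)) + ?g (?N a (J c)) (?N (J b) d)" for a b c d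
  proof -
    obtain s where s: "?N a c - ?N (J a) (J c) = X s q" "?N (J a) c + ?N a (J c) = X (J s) q"
      by (rule nabla_J[OF q])
    obtain t where t: "?N b d - ?N (J b) (J d) = X t q" "?N (J b) d + ?N b (J d) = X (J t) q"
      by (rule nabla_J[OF q])
    have "?g (?N a c - ?N (J a) (J c)) (?N b d - ?N (J b) (J d)) =
       ?g (?N (J a) c + ?N a (J c)) (?N (J b) d + ?N b (J d))"
      unfolding s t using HJ[OF q, of s t] by (simp add: H_def)
    then show ?thesis
      by (simp add: bilinear_lsub[OF B] bilinear_rsub[OF B] bilinear_ladd[OF B] bilinear_radd[OF B])
  qed
  note R = Riem_eq[OF q]
  \<comment> \<open>The two instances of \<open>quad\<close> match the two quadratic terms of
    \<open>Riem_eq\<close>; the second derivatives cancel once each \<open>J\<close> in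
    \<open>H\<close> has been moved to the second slot.\<close>
  show ?thesis
    using R[of x y z w] R[of "J x" "J y" "J z" "J w"] R[of "J x" "J y" z w] R[of x y "J z" "J w"]
      R[of "J x" y "J z" w] R[of x "J y" z "J w"] R[of "J x" y z "J w"] R[of x "J y" "J z" w]
      quad[of x z y w] quad[of y z x w]
    by (simp add: pd_pd_H_J[OF q] pd_pd_H_neg[OF q] J)
qed

end

section \<open>Tangent vectors in local coordinates\<close>

lemma chart_onD:
  assumes "chart_on T c"
  shows "inj_on (snd c) (fst c)" "open (chart_range c)" "openin T (fst c)"
    "Q \<in> fst c \<Longrightarrow> chart_inv c (snd c Q) = Q"
proof -
  have "topspace (subtopology T (fst c)) = fst c"
    using assms openin_subset by (fastforce simp: chart_on_def)
  then show "inj_on (snd c) (fst c)"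
    using assms homeomorphic_imp_injective_map unfolding chart_on_def by metis
  then show "Q \<in> fst c \<Longrightarrow> chart_inv c (snd c Q) = Q" by simp
qed (use assms in \<open>auto simp: chart_on_def\<close>)

lemma open_chart_image:
  assumes "chart_on T c" "openin T D"
  shows "open (snd c ` (fst c \<inter> D))"
proof -
  have "openin (subtopology T (fst c)) (fst c \<inter> D)"
    using assms(2) by (simp add: Int_commute openin_subtopology_Int)
  then have "openin (top_of_set (chart_range c)) (snd c ` (fst c \<inter> D))"
    using assms(1) homeomorphic_imp_open_map unfolding chart_on_def open_map_def by blast
  then show ?thesis using chart_onD(2)[OF assms(1)] openin_open_eq by blast
qed

lemma transition_apply: "chart_on T c \<Longrightarrow> Q \<in> fst c \<Longrightarrow> transition c d (snd c Q) = snd d Q"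
  by (simp add: transition_def chart_onD)

lemma transition_chain:
  assumes c: "chart_on T c" and d: "chart_on T d" and Q: "Q \<in> fst c" "Q \<in> fst d"
    and "transition c d differentiable (at (snd c Q))" "transition d e differentiable (at (snd d Q))"
  shows "pd a (transition c e) (snd c Q) = pd (pd a (transition c d) (snd c Q)) (transition d e) (snd d Q)"
proof -
  have "pd a (transition c e) (snd c Q) = pd a (\<lambda>q. transition d e (transition c d q)) (snd c Q)"
    by (rule pd_cong_open[OF open_chart_image[OF c chart_onD(3)[OF d]]])
      (use Q in \<open>auto simp: transition_apply[OF c] transition_apply[OF d]\<close>)
  also have "\<dots> = pd (pd a (transition c d) (snd c Q)) (transition d e) (transition c d (snd c Q))"
    using has_derivative_compose[OF has_derivative_pd[OF assms(5)] has_derivative_pd, of "transition d e"]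
      assms(6) by (intro pd_eqI) (simp add: transition_apply[OF c Q(1)])
  finally show ?thesis by (simp add: transition_apply[OF c Q(1)])
qed

lemma pd_transition_self:
  assumes c: "chart_on T c" and Q: "Q \<in> fst c"
  shows "pd a (transition c c) (snd c Q) = a"
proof -
  have "pd a (transition c c) (snd c Q) = pd a (\<lambda>q. q) (snd c Q)"
    by (rule pd_cong_open[OF chart_onD(2)[OF c]]) (use Q in \<open>auto simp: transition_apply[OF c]\<close>)
  then show ?thesis by (simp add: pd_eqI[OF has_derivative_ident])
qed

lemma local_coordinates_transition_smooth:
  assumes "local_coordinates M c" "d \<in> atlas M"
  shows "smooth_on (snd c ` (fst c \<inter> fst d)) (transition c d)"
    "smooth_on (snd d ` (fst c \<inter> fst d)) (transition d c)"
  using assms by (auto simp: local_coordinates_def compatible_def)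

lemma local_coordinates_transition_diff:
  assumes "local_coordinates M c" "d \<in> atlas M" "Q \<in> fst c" "Q \<in> fst d"
  shows "transition c d differentiable (at (snd c Q))" "transition d c differentiable (at (snd d Q))"
  using local_coordinates_transition_smooth[OF assms(1,2)] smooth_on_differentiable assms(3,4) by blast+

lemma coord_vec_lincomb:
  assumes "local_coordinates M c" "Q \<in> fst c"
  shows "coord_vec M c Q (r *\<^sub>R a + s *\<^sub>R b) = tlincomb r (coord_vec M c Q a) s (coord_vec M c Q b)"
proof
  fix d
  show "coord_vec M c Q (r *\<^sub>R a + s *\<^sub>R b) d = tlincomb r (coord_vec M c Q a) s (coord_vec M c Q b) d"
    using linear_pd[OF local_coordinates_transition_diff(1)[OF assms(1) _ assms(2)], of d]
    by (simp add: coord_vec_def tlincomb_def charts_at_def linear_iff)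
qed

locale smooth_manifold_charts =
  fixes M :: "('m, 'e::euclidean_space, 'z) manifold_scheme"
  assumes smooth_M: "smooth_manifold M"
begin

lemma atlas_local: "c \<in> atlas M \<Longrightarrow> local_coordinates M c"
  using smooth_M by (simp add: smooth_manifold_def)

lemma local_chart: "local_coordinates M c \<Longrightarrow> chart_on (mtop M) c"
  by (simp add: local_coordinates_def)

lemma coord_vec_component:
  "c \<in> atlas M \<Longrightarrow> Q \<in> fst c \<Longrightarrow> coord_vec M c Q a c = a"
  using pd_transition_self[OF local_chart[OF atlas_local]] by (simp add: coord_vec_def charts_at_def)

lemma coord_vec_tangent:
  assumes c: "local_coordinates M c" and Q: "Q \<in> fst c"
  shows "coord_vec M c Q a \<in> tangent_space M Q"
proof -
  have *: "coord_vec M c Q a e = pd (coord_vec M c Q a d) (transition d e) (snd d Q)"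
    if "d \<in> charts_at M Q" "e \<in> charts_at M Q" for d e
    using that Q c transition_chain[OF local_chart[OF c] local_chart[OF atlas_local], of d Q e]
    by (simp add: coord_vec_def charts_at_def local_coordinates_transition_diff(1)[OF c]
        local_coordinates_transition_diff(1)[OF atlas_local])
  show ?thesis unfolding tangent_space_def mem_Collect_eq
    by (intro conjI ballI allI impI *) (simp_all add: coord_vec_def)
qed

lemma tangent_eq_coord_vec:
  assumes "u \<in> tangent_space M Q" "c \<in> charts_at M Q"
  shows "u = coord_vec M c Q (u c)"
proof
  fix d
  have "u d = pd (u c) (transition c d) (snd c Q)" if "d \<in> charts_at M Q"
    using assms that unfolding tangent_space_def by blast
  moreover have "u d = 0" if "d \<notin> charts_at M Q"
    using assms that unfolding tangent_space_def by blast
  ultimately show "u d = coord_vec M c Q (u c) d"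
    unfolding coord_vec_def by (cases "d \<in> charts_at M Q") simp_all
qed

lemma coord_vec_change:
  assumes "local_coordinates M c" "Q \<in> fst c" "d \<in> charts_at M Q"
  shows "coord_vec M c Q a = coord_vec M d Q (pd a (transition c d) (snd c Q))"
  using tangent_eq_coord_vec[OF coord_vec_tangent[OF assms(1,2)] assms(3), of a] assms(3)
  by (simp add: coord_vec_def)

end

section \<open>Metric and complex structure in charts\<close>

lemma riemannian_metricD:
  assumes "riemannian_metric M" "P \<in> topspace (mtop M)" "u \<in> tangent_space M P" "v \<in> tangent_space M P"
  shows "metric M P u v = metric M P v u"
    "w \<in> tangent_space M P \<Longrightarrow>
      metric M P (tlincomb r u s v) w = r * metric M P u w + s * metric M P v w"
    "u \<noteq> (\<lambda>c. 0) \<Longrightarrow> metric M P u u > 0"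
  using assms by (simp_all add: riemannian_metric_def)

lemma almost_complex_structureD:
  assumes "almost_complex_structure M" "P \<in> topspace (mtop M)" "u \<in> tangent_space M P" "v \<in> tangent_space M P"
  shows "acs M P u \<in> tangent_space M P"
    "acs M P (tlincomb r u s v) = tlincomb r (acs M P u) s (acs M P v)"
  using assms by (simp_all add: almost_complex_structure_def)

lemma metric_in_chart_apply:
  assumes "chart_on T c" "Q \<in> fst c"
  shows "metric_in_chart M c (snd c Q) a b = metric M Q (coord_vec M c Q a) (coord_vec M c Q b)"
  using assms by (simp add: metric_in_chart_def chart_onD)

lemma chart_metric_metric_in_chart:
  assumes M: "smooth_manifold M" "riemannian_metric M" and c: "c \<in> atlas M"
  shows "chart_metric (chart_range c) (metric_in_chart M c)"
proof
  interpret smooth_manifold_charts M using M(1) by unfold_locales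
  note lc = atlas_local[OF c]
  note ch = local_chart[OF lc]
  have top: "Q \<in> topspace (mtop M)" if "Q \<in> fst c" for Q
    using that chart_onD(3)[OF ch] openin_subset by blast
  show "open (chart_range c)" using chart_onD[OF ch] by blast
  show "smooth_on (chart_range c) (\<lambda>p. metric_in_chart M c p a b)" for a b
    using M(2) c by (simp add: riemannian_metric_def)
  fix p assume "p \<in> chart_range c"
  then obtain Q where Q: "Q \<in> fst c" "p = snd c Q" by auto
  note h = metric_in_chart_apply[OF ch Q(1), of M]
  note t = coord_vec_tangent[OF lc Q(1)]
  note m = riemannian_metricD[OF M(2) top[OF Q(1)] t t]
  show symm: "metric_in_chart M c p a b = metric_in_chart M c p b a" for a b
    unfolding Q h by (rule m(1))
  have "linear (\<lambda>a. metric_in_chart M c p a b)" for b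
  proof (rule linearI)
    show "metric_in_chart M c p (a + a') b = metric_in_chart M c p a b + metric_in_chart M c p a' b" for a a'
      using coord_vec_lincomb[OF lc Q(1), of 1 a 1 a'] m(2)[OF t, of 1 a 1 a' b] unfolding Q h by simp
    show "metric_in_chart M c p (r *\<^sub>R a) b = r *\<^sub>R metric_in_chart M c p a b" for r a
      using coord_vec_lincomb[OF lc Q(1), of r a 0 0] m(2)[OF t, of r a 0 0 b] unfolding Q h by simp
  qed
  moreover have "metric_in_chart M c p a = (\<lambda>b. metric_in_chart M c p b a)" for a
    using symm by blast
  ultimately show "bilinear (metric_in_chart M c p)" unfolding bilinear_def by metis
  show "metric_in_chart M c p a a > 0" if "a \<noteq> 0" for a
  proof -
    have "coord_vec M c Q a \<noteq> (\<lambda>c. 0)" using coord_vec_component[OF c Q(1), of a] that by auto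
    then show ?thesis unfolding Q h using riemannian_metricD(3)[OF M(2) top[OF Q(1)] t t] by blast
  qed
qed

text \<open>Multiplication by the imaginary unit, with \<open>(x, y)\<close> read as x + iy.\<close>

definition standard_J :: "'n::finite xy_space \<Rightarrow> 'n xy_space" where
  "standard_J a = (- snd a, fst a)"

lemma standard_J: "linear standard_J" "standard_J (standard_J a) = - a"
  by (auto simp: standard_J_def linear_iff prod_eq_iff)

lemma standard_J_axis:
  "standard_J (axis i 1, 0) = (0, axis i 1)" "standard_J (0, axis i 1) = - (axis i 1, 0)"
  by (simp_all add: standard_J_def)

text \<open>Integrability prescribes \<open>acs\<close> only on the coordinate basis; in each chart
  component both sides are linear in \<open>a\<close>, so agreement on the basis is enough.\<close>

lemma acs_coord_vec:
  fixes M :: "('m, 'n::finite xy_space, 'z) almost_hermitian_scheme"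
  assumes M: "smooth_manifold M" "almost_complex_structure M"
    and c: "local_coordinates M c" "Q \<in> fst c"
    and int: "\<And>i::'n. acs M Q (coord_vec M c Q (axis i 1, 0)) = coord_vec M c Q (0, axis i 1)"
      "\<And>i::'n. acs M Q (coord_vec M c Q (0, axis i 1)) = (\<lambda>d. - coord_vec M c Q (axis i 1, 0) d)"
  shows "acs M Q (coord_vec M c Q a) = coord_vec M c Q (standard_J a)"
proof
  fix d
  interpret smooth_manifold_charts M using M(1) by unfold_locales
  have top: "Q \<in> topspace (mtop M)"
    using chart_onD(3)[OF local_chart[OF c(1)]] openin_subset c(2) by blast
  have lin: "linear (\<lambda>a. coord_vec M c Q a d)"
    using coord_vec_lincomb[OF c, of 1 _ 1] coord_vec_lincomb[OF c, of _ _ 0 0]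
    by (simp add: linear_iff tlincomb_def)
  have l1: "linear (\<lambda>a. acs M Q (coord_vec M c Q a) d)"
    using coord_vec_lincomb[OF c, of 1 _ 1] coord_vec_lincomb[OF c, of _ _ 0 0]
      almost_complex_structureD(2)[OF M(2) top coord_vec_tangent[OF c] coord_vec_tangent[OF c], of 1 _ 1]
      almost_complex_structureD(2)[OF M(2) top coord_vec_tangent[OF c] coord_vec_tangent[OF c], of _ _ 0 0]
    by (simp add: linear_iff tlincomb_def)
  have l2: "linear (\<lambda>a. coord_vec M c Q (standard_J a) d)"
    using linear_compose[OF standard_J(1) lin] by (simp add: o_def)
  have eq: "acs M Q (coord_vec M c Q b) d = coord_vec M c Q (standard_J b) d" if b: "b \<in> Basis" for b
  proof -
    consider i where "b = (axis i 1, 0)" | i where "b = (0, axis i 1)"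
      using b by (auto simp: Basis_prod_def Basis_vec_def)
    then show ?thesis
    proof cases
      case 1
      then show ?thesis by (simp only: int standard_J_axis)
    next
      case 2
      then show ?thesis by (simp only: int standard_J_axis linear_neg[OF lin])
    qed
  qed
  show "acs M Q (coord_vec M c Q a) d = coord_vec M c Q (standard_J a) d"
    using linear_eq_stdbasis[OF l1 l2 eq] by (rule fun_cong)
qed

section \<open>The Gray identity on Hermitian manifolds\<close>

theorem hermitian_manifold_gray:
  fixes M :: "('m, 'n::finite xy_space, 'z) almost_hermitian_scheme"
  assumes A: "A \<in> curvature_tensors" and M: "hermitian_manifold M"
    and real: "geometrically_realized ip J A M P"
  shows "A \<in> gray_space J"
proof -
  have sm: "smooth_manifold M" and rm: "riemannian_metric M" and ac: "almost_complex_structure M"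
    and herm: "\<And>Q u v. \<lbrakk>Q \<in> topspace (mtop M); u \<in> tangent_space M Q; v \<in> tangent_space M Q\<rbrakk> \<Longrightarrow>
      metric M Q (acs M Q u) (acs M Q v) = metric M Q u v"
    using M by (auto simp: hermitian_manifold_def almost_hermitian_manifold_def)
  interpret smooth_manifold_charts M using sm by unfold_locales
  from real obtain \<phi> where P: "P \<in> topspace (mtop M)" and bij: "bij_betw \<phi> UNIV (tangent_space M P)"
    and \<phi>J: "\<And>x. \<phi> (J x) = acs M P (\<phi> x)"
    and \<phi>R: "\<And>x y z w. A x y z w = riemann_tensor M P (\<phi> x) (\<phi> y) (\<phi> z) (\<phi> w)"
    unfolding geometrically_realized_def by blast
  \<comment> \<open>The same choice as in \<open>riemann_tensor\<close>, so the curvature at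
    \<open>P\<close> is the one computed in this chart.\<close>
  define c where "c = (SOME c. c \<in> charts_at M P)"
  have "P \<in> (\<Union>c\<in>atlas M. fst c)" using P sm by (simp add: smooth_manifold_def)
  then have "\<exists>c. c \<in> charts_at M P" unfolding charts_at_def by blast
  then have "c \<in> charts_at M P" unfolding c_def by (rule someI_ex)
  then have c: "c \<in> atlas M" "P \<in> fst c" by (auto simp: charts_at_def)
  obtain d where d: "local_coordinates M d" "P \<in> fst d"
    and int: "\<And>Q i. Q \<in> fst d \<Longrightarrow> acs M Q (coord_vec M d Q (axis i 1, 0)) = coord_vec M d Q (0, axis i 1)"
      "\<And>Q i. Q \<in> fst d \<Longrightarrow> acs M Q (coord_vec M d Q (0, axis i 1)) = (\<lambda>e. - coord_vec M d Q (axis i 1, 0) e)"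
    using M P unfolding hermitian_manifold_def integrable_acs_def by blast
  note cc = local_chart[OF atlas_local[OF c(1)]] and cd = local_chart[OF d(1)]
  define W where "W = snd d ` (fst d \<inter> fst c)"
  have change: "coord_vec M d Q a = coord_vec M c Q (pd a (transition d c) (snd d Q))"
    if "Q \<in> fst d" "Q \<in> fst c" for Q a
    using coord_vec_change[OF d(1) that(1), of c a] that c by (simp add: charts_at_def)
  interpret chart_metric "chart_range c" "metric_in_chart M c"
    by (rule chart_metric_metric_in_chart[OF sm rm c(1)])
  interpret chart_frame "chart_range c" "metric_in_chart M c" W "transition d c"
  proof
    show "open W" unfolding W_def by (rule open_chart_image[OF cd chart_onD(3)[OF cc]])
    show "transition d c q \<in> chart_range c" if "q \<in> W" for q
      using that unfolding W_def by (auto simp: transition_apply[OF cd])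
    show "smooth_on W (transition d c)"
      unfolding W_def by (rule local_coordinates_transition_smooth[OF d(1) c(1)])
  qed
  have H_metric: "H a b (snd d Q) = metric M Q (coord_vec M d Q a) (coord_vec M d Q b)"
    if "Q \<in> fst d" "Q \<in> fst c" for Q a b
    unfolding H_def change[OF that] transition_apply[OF cd that(1)]
    by (rule metric_in_chart_apply[OF cc that(2)])
  interpret hermitian_frame "chart_range c" "metric_in_chart M c" W "transition d c" standard_J
  proof (intro hermitian_frame.intro chart_frame_axioms hermitian_frame_axioms.intro)
    show "linear (standard_J :: 'n xy_space \<Rightarrow> _)" by (rule standard_J)
    show "standard_J (standard_J a) = - a" for a :: "'n xy_space" by (rule standard_J)
    fix q assume "q \<in> W"
    then obtain Q where Q: "Q \<in> fst d" "Q \<in> fst c" "q = snd d Q" unfolding W_def by auto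
    have top: "Q \<in> topspace (mtop M)" using chart_onD(3)[OF cc] openin_subset Q(2) by blast
    show "H (standard_J a) (standard_J b) q = H a b q" for a b
      unfolding Q H_metric[OF Q(1,2)] acs_coord_vec[OF sm ac d(1) Q(1) int[OF Q(1)], symmetric]
      by (intro herm top coord_vec_tangent d Q)
    \<comment> \<open>The derivative of the reverse transition gives preimages, by the chain rule
      along \<open>c\<close>, \<open>d\<close>, \<open>c\<close>.\<close>
    show "surj (\<lambda>a. X a q)"
    proof (rule surjI)
      fix e
      have "pd e (transition c c) (snd c Q) = X (pd e (transition c d) (snd c Q)) (snd d Q)"
        by (rule transition_chain[OF cc cd Q(2,1)]) (rule local_coordinates_transition_diff[OF d(1) c(1) Q(1,2)])+
      then show "X (pd e (transition c d) (snd c Q)) q = e"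
        by (simp add: pd_transition_self[OF cc Q(2)] Q(3))
    qed
  qed
  let ?q = "snd d P"
  have q: "?q \<in> W" using c d by (auto simp: W_def)
  have "\<exists>a. \<phi> x = coord_vec M d P a" for x
  proof -
    have "\<phi> x \<in> tangent_space M P" using bij by (auto simp: bij_betw_def)
    then have "\<phi> x = coord_vec M c P (\<phi> x c)" using \<open>c \<in> charts_at M P\<close> by (rule tangent_eq_coord_vec)
    moreover obtain a where "\<phi> x c = X a ?q" using surj_X[OF q] by (metis surjD)
    ultimately show ?thesis using change[OF d(2) c(2)] by metis
  qed
  \<comment> \<open>\<open>\<alpha> x\<close> is a component vector of \<open>\<phi> x\<close> in
    the adapted coordinates \<open>d\<close>.\<close>
  then obtain \<alpha> where \<alpha>: "\<And>x. \<phi> x = coord_vec M d P (\<alpha> x)" by metis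
  have X\<alpha>: "\<phi> x c = X (\<alpha> x) ?q" for x
    unfolding \<alpha> using \<open>c \<in> charts_at M P\<close> by (simp add: coord_vec_def)
  \<comment> \<open>Agreement after applying \<open>X\<close> is enough, because \<open>Riem\<close>
    depends on its arguments only through the frame vectors at the point.\<close>
  have "X (\<alpha> (J x)) ?q = X (standard_J (\<alpha> x)) ?q" for x
  proof -
    have "\<phi> (J x) = coord_vec M d P (standard_J (\<alpha> x))"
      unfolding \<phi>J \<alpha>[of x] by (rule acs_coord_vec[OF sm ac d int[OF d(2)]])
    then show ?thesis using X\<alpha>[of "J x"] \<open>c \<in> charts_at M P\<close> by (simp add: coord_vec_def)
  qed
  then have "Riem ?q (\<alpha> x) (\<alpha> y) (\<alpha> z) (\<alpha> w) = A x y z w"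
    "X (\<alpha> (J x)) ?q = X (standard_J (\<alpha> x)) ?q" for x y z w
    unfolding \<phi>R riemann_tensor_def c_def[symmetric] Let_def Riem_def X\<alpha>
    by (simp_all add: transition_apply[OF cd d(2)])
  note R = this
  have "A x y z w + A (J x) (J y) (J z) (J w) =
       A (J x) (J y) z w + A x y (J z) (J w) + A (J x) y (J z) w
       + A x (J y) z (J w) + A (J x) y z (J w) + A x (J y) (J z) w" for x y z w
    using Riem_gray[OF q, of "\<alpha> x" "\<alpha> y" "\<alpha> z" "\<alpha> w"]
    unfolding R(1)[symmetric] unfolding Riem_def R(2) .
  then show ?thesis using A by (simp add: gray_space_def)
qed

section \<open>A quadratic metric with prescribed curvature\<close>

lemma curvature_tensorsD:
  assumes "A \<in> curvature_tensors"
  shows "linear (\<lambda>x. A x y z w)" "linear (\<lambda>y. A x y z w)" "linear (\<lambda>z. A x y z w)" "linear (\<lambda>w. A x y z w)"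
    "A x y z w = - A y x z w" "A x y z w = A z w x y" "A x y z w + A y z x w + A z x y w = 0"
proof -
  note D0 = assms[unfolded curvature_tensors_def mem_Collect_eq]
  note D1 = D0[THEN conjunct2] and D2 = D0[THEN conjunct2, THEN conjunct2]
  note D3 = D2[THEN conjunct2]
  show "linear (\<lambda>x. A x y z w)" by (rule D0[THEN conjunct1, rule_format])
  show "linear (\<lambda>y. A x y z w)" by (rule D1[THEN conjunct1, rule_format])
  show "linear (\<lambda>z. A x y z w)" by (rule D2[THEN conjunct1, rule_format])
  show "linear (\<lambda>w. A x y z w)" by (rule D3[THEN conjunct1, rule_format])
  show "A x y z w = - A y x z w" "A x y z w = A z w x y" "A x y z w + A y z x w + A z x y w = 0"
    using D3[THEN conjunct2] by blast+
qed

text \<open>The pair symmetries leave three values up to sign, and the Bianchi identity expresses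
  one by the other two. The rules thus bring all 24 orders of the arguments to
  \<open>A p q r s\<close> and \<open>A p r q s\<close>.\<close>

lemma curvature_permutations:
  assumes "A \<in> curvature_tensors"
  shows
    "A p q s r = - A p q r s" "A q p r s = - A p q r s" "A q p s r = A p q r s" "A r s p q = A p q r s"
    "A s r p q = - A p q r s" "A r s q p = - A p q r s" "A s r q p = A p q r s"
    "A p r s q = - A p r q s" "A r p q s = - A p r q s" "A r p s q = A p r q s" "A q s p r = A p r q s"
    "A s q p r = - A p r q s" "A q s r p = - A p r q s" "A s q r p = A p r q s"
    "A p s q r = A p r q s - A p q r s" "A p s r q = A p q r s - A p r q s"
    "A s p q r = A p q r s - A p r q s" "A s p r q = A p r q s - A p q r s"
    "A q r p s = A p r q s - A p q r s" "A r q p s = A p q r s - A p r q s"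
    "A q r s p = A p q r s - A p r q s" "A r q s p = A p r q s - A p q r s"
proof -
  note D = curvature_tensorsD[OF assms]
  have 1: "A q p r s = - A p q r s" for p q r s by (rule D)
  have 2: "A p q s r = - A p q r s" for p q r s using D(5,6) by metis
  have 3: "A r s p q = A p q r s" for p q r s by (rule D)
  have t: "A p s q r = A p r q s - A p q r s" for p q r s
    using D(7)[of p q r s] 1[of p r q s] 3[of p s q r] by linarith
  show "A p q s r = - A p q r s" "A q p r s = - A p q r s" "A q p s r = A p q r s" "A r s p q = A p q r s"
    "A s r p q = - A p q r s" "A r s q p = - A p q r s" "A s r q p = A p q r s"
    "A p r s q = - A p r q s" "A r p q s = - A p r q s" "A r p s q = A p r q s" "A q s p r = A p r q s"
    "A s q p r = - A p r q s" "A q s r p = - A p r q s" "A s q r p = A p r q s"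
    using 1 2 3 by metis+
  show "A p s q r = A p r q s - A p q r s" by (rule t)
  then show "A p s r q = A p q r s - A p r q s" "A s p q r = A p q r s - A p r q s"
    "A s p r q = A p r q s - A p q r s" "A q r p s = A p r q s - A p q r s"
    "A r q p s = A p q r s - A p r q s" "A q r s p = A p q r s - A p r q s"
    "A r q s p = A p r q s - A p q r s"
    using 1 2 3 by (metis minus_diff_eq minus_minus)+
qed

section \<open>The quadratic coefficient of the metric\<close>

text \<open>The expression before symmetrization. Slots \<open>a\<close> and \<open>c\<close> will
  receive the point, slots \<open>b\<close> and \<open>d\<close> are those of the metric; in
  \<open>A\<close> the two kinds alternate.\<close>

definition theta0 ::
    "('v \<Rightarrow> 'v) \<Rightarrow> ('v \<Rightarrow> 'v \<Rightarrow> 'v \<Rightarrow> 'v \<Rightarrow> real) \<Rightarrow> 'v \<Rightarrow> 'v \<Rightarrow> 'v \<Rightarrow> 'v \<Rightarrow> real" where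
  "theta0 J A a c b d =
     7 / 96 * A a b c d + 1 / 16 * A a b (J c) (J d) - 1 / 96 * A (J a) b (J c) d"

definition theta1 ::
    "('v \<Rightarrow> 'v) \<Rightarrow> ('v \<Rightarrow> 'v \<Rightarrow> 'v \<Rightarrow> 'v \<Rightarrow> real) \<Rightarrow> 'v \<Rightarrow> 'v \<Rightarrow> 'v \<Rightarrow> 'v \<Rightarrow> real" where
  "theta1 J A a c b d = theta0 J A a c b d + theta0 J A c a b d + theta0 J A a c d b + theta0 J A c a d b"

text \<open>The curvature at the origin of the metric \<open>\<langle>b, d\<rangle> + \<Theta>(q, q, b, d)\<close> is linear in \<open>\<Theta>\<close>. On the
  tensors satisfying the Gray identity \<open>theta\<close> is a right inverse of this map with values in the
  tensors that are symmetric in each pair of arguments and Hermitian in the second one. Its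
  coefficients were found by solving a linear system.\<close>

definition theta ::
    "('v \<Rightarrow> 'v) \<Rightarrow> ('v \<Rightarrow> 'v \<Rightarrow> 'v \<Rightarrow> 'v \<Rightarrow> real) \<Rightarrow> 'v \<Rightarrow> 'v \<Rightarrow> 'v \<Rightarrow> 'v \<Rightarrow> real" where
  "theta J A a c b d = theta1 J A a c b d + theta1 J A a c (J b) (J d)"

lemma theta_sym: "theta J A c a b d = theta J A a c b d" "theta J A a c d b = theta J A a c b d"
  by (simp_all add: theta_def theta1_def)

lemma linear_theta:
  assumes A: "A \<in> curvature_tensors" and J: "linear J"
  shows "linear (\<lambda>a. theta J A a c b d)" "linear (\<lambda>b. theta J A a c b d)"
proof -
  note D = curvature_tensorsD(1-4)[OF A]
  have J': "J (x + y) = J x + J y" "J (r *\<^sub>R x) = r *\<^sub>R J x" for x y r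
    using J by (simp_all add: linear_iff)
  have add: "A (x + x') y z w = A x y z w + A x' y z w" "A x (y + y') z w = A x y z w + A x y' z w"
    "A x y (z + z') w = A x y z w + A x y z' w" "A x y z (w + w') = A x y z w + A x y z w'"
    for x x' y y' z z' w w'
    using D[THEN linear_add] by simp_all
  have scale: "A (r *\<^sub>R x) y z w = r * A x y z w" "A x (r *\<^sub>R y) z w = r * A x y z w"
    "A x y (r *\<^sub>R z) w = r * A x y z w" "A x y z (r *\<^sub>R w) = r * A x y z w" for r x y z w
    using D[THEN linear_scale] by simp_all
  have t0: "linear (\<lambda>a. theta0 J A a c b d)" "linear (\<lambda>c. theta0 J A a c b d)"
    "linear (\<lambda>b. theta0 J A a c b d)" "linear (\<lambda>d. theta0 J A a c b d)" for a b c d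
    unfolding theta0_def by (auto intro!: linearI simp: J' add scale algebra_simps add_divide_distrib)
  have t1: "linear (\<lambda>a. theta1 J A a c b d)" "linear (\<lambda>b. theta1 J A a c b d)" for a b c d
    unfolding theta1_def by (intro linear_compose_add t0)+
  have "linear (\<lambda>b. theta1 J A a c (J b) (J d))"
    using linear_compose[OF J t1(2)] by (simp add: o_def)
  then show "linear (\<lambda>a. theta J A a c b d)" "linear (\<lambda>b. theta J A a c b d)"
    unfolding theta_def by (intro linear_compose_add t1; assumption)+
qed

text \<open>\<open>theta\<close> sums \<open>theta1\<close> over the action of \<open>J\<close> on
  the metric slots. Applying \<open>J\<close> again exchanges the two summands, since the two signs
  from \<open>J (J b)\<close> and \<open>J (J d)\<close> cancel.\<close>

lemma theta_hermitian:
  assumes A: "A \<in> curvature_tensors" and J: "\<And>x. J (J x) = - x"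
  shows "theta J A a c (J b) (J d) = theta J A a c b d"
proof -
  note D = curvature_tensorsD(1-4)[OF A]
  have "J (- x) = - J x" for x by (metis J)
  then show ?thesis
    unfolding theta_def theta1_def theta0_def
    by (simp add: J linear_neg[OF D(1)] linear_neg[OF D(2)] linear_neg[OF D(3)] linear_neg[OF D(4)])
qed

text \<open>The left side is the curvature at the origin of the metric with quadratic part
  \<open>theta\<close>. The identity is a linear consequence of the curvature symmetries and the
  Gray identity.\<close>

lemma theta_curvature:
  assumes gray: "A \<in> gray_space J" and J: "\<And>x. J (J x) = - x"
  shows "theta J A a c b d - theta J A a d b c - theta J A b c a d + theta J A b d a c = A a b c d"
proof -
  have A: "A \<in> curvature_tensors" and G: "\<And>x y z w. A x y z w + A (J x) (J y) (J z) (J w) =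
       A (J x) (J y) z w + A x y (J z) (J w) + A (J x) y (J z) w
       + A x (J y) z (J w) + A (J x) y z (J w) + A x (J y) (J z) w"
    using gray unfolding gray_space_def by blast+
  note D = curvature_tensorsD(1-4)[OF A]
  note P = curvature_permutations[OF A]
  \<comment> \<open>One instance for each placement of an even number of \<open>J\<close>, the only
    ones that occur; each placement leaves two values of \<open>A\<close>.\<close>
  note rules = P[where p = a and q = b and r = c and s = d]
    P[where p = "J a" and q = "J b" and r = c and s = d]
    P[where p = "J a" and q = b and r = "J c" and s = d]
    P[where p = "J a" and q = b and r = c and s = "J d"]
    P[where p = a and q = "J b" and r = "J c" and s = d]
    P[where p = a and q = "J b" and r = c and s = "J d"]
    P[where p = a and q = b and r = "J c" and s = "J d"]
    P[where p = "J a" and q = "J b" and r = "J c" and s = "J d"]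
  show ?thesis
    \<comment> \<open>These two orders of the arguments give the linear relations between the
      remaining sixteen values.\<close>
    using G[of a b c d] G[of a c b d]
    unfolding theta_def theta1_def theta0_def
    by (simp only: J linear_neg[OF D(1)] linear_neg[OF D(2)] linear_neg[OF D(3)] linear_neg[OF D(4)] rules)
      (simp only: algebra_simps add_divide_distrib mult_minus_left mult_minus_right; linarith)
qed

section \<open>Realization\<close>

lemma complex_basis_extend:
  fixes J :: "'v::real_vector \<Rightarrow> 'v"
  assumes J: "linear J" "\<And>x. J (J x) = - x" and B: "independent (B \<union> J ` B)" and v: "v \<notin> span (B \<union> J ` B)"
  shows "independent (insert (J v) (insert v (B \<union> J ` B)))" "J v \<notin> span (insert v (B \<union> J ` B))"
proof -
  let ?S = "span (B \<union> J ` B)"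
  have inv: "J x \<in> ?S" if "x \<in> ?S" for x
    using that
  proof (induction rule: span_induct_alt)
    case base
    then show ?case by (simp add: linear_0[OF J(1)] span_zero)
  next
    case (step c x y)
    consider "x \<in> B" | y where "y \<in> B" "x = J y" using step(1) by blast
    then have "J x \<in> ?S"
    proof cases
      case 1
      then show ?thesis by (intro span_base) blast
    next
      case 2
      then have "y \<in> ?S" by (intro span_base) blast
      then show ?thesis by (simp add: 2(2) J(2) span_neg)
    qed
    then show ?case using step by (simp add: linear_add[OF J(1)] linear_scale[OF J(1)] span_add span_scale)
  qed
  show *: "J v \<notin> span (insert v (B \<union> J ` B))"
  proof
    assume "J v \<in> span (insert v (B \<union> J ` B))"
    then obtain k where k: "J v - k *\<^sub>R v \<in> ?S" using span_breakdown_eq by blast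
    have "J (J v - k *\<^sub>R v) + k *\<^sub>R (J v - k *\<^sub>R v) \<in> ?S" by (intro span_add inv span_scale k)
    also have "J (J v - k *\<^sub>R v) + k *\<^sub>R (J v - k *\<^sub>R v) = - ((1 + k * k) *\<^sub>R v)"
      by (simp add: linear_diff[OF J(1)] linear_scale[OF J(1)] J(2) algebra_simps)
    finally have "(1 + k * k) *\<^sub>R v \<in> ?S" using span_neg by fastforce
    then have "(1 / (1 + k * k)) *\<^sub>R (1 + k * k) *\<^sub>R v \<in> ?S" by (rule span_scale)
    moreover have "1 + k * k \<noteq> 0" using zero_le_square[of k] by linarith
    ultimately show False using v by simp
  qed
  then show "independent (insert (J v) (insert v (B \<union> J ` B)))"
    using B v by (meson independent_insertI)
qed

text \<open>While \<open>k < n\<close>, the \<open>2 * k\<close> vectors found so far cannot span,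
  so some \<open>v\<close> outside their span contributes the pair \<open>v\<close>,
  \<open>J v\<close>.\<close>

lemma complex_basis_exists:
  fixes J :: "'v::real_vector \<Rightarrow> 'v"
  assumes J: "linear J" "\<And>x. J (J x) = - x" and dim: "dim (UNIV :: 'v set) = 2 * n" and "k \<le> n"
  shows "\<exists>B. finite B \<and> card B = k \<and> card (B \<union> J ` B) = 2 * k \<and> independent (B \<union> J ` B)"
  using \<open>k \<le> n\<close>
proof (induction k)
  case 0
  then show ?case by (intro exI[of _ "{}"]) (simp add: independent_empty)
next
  case (Suc k)
  then obtain B where B: "finite B" "card B = k" "card (B \<union> J ` B) = 2 * k" "independent (B \<union> J ` B)"
    by auto
  have "span (B \<union> J ` B) \<noteq> UNIV"
  proof
    assume "span (B \<union> J ` B) = UNIV"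
    then have "card (B \<union> J ` B) = 2 * n"
      using basis_card_eq_dim[of "B \<union> J ` B" UNIV] B(4) dim by auto
    then show False using B(3) Suc.prems by simp
  qed
  then obtain v where v: "v \<notin> span (B \<union> J ` B)" by blast
  note ext = complex_basis_extend[OF J B(4) v]
  have eq: "insert v B \<union> J ` insert v B = insert (J v) (insert v (B \<union> J ` B))" by auto
  have n: "v \<notin> B \<union> J ` B" "J v \<notin> insert v (B \<union> J ` B)"
    by (rule contrapos_nn[OF v span_base], assumption) (rule contrapos_nn[OF ext(2) span_base], assumption)
  have fin: "finite (B \<union> J ` B)" using B(1) by blast
  have "card (insert v B \<union> J ` insert v B) = 2 * Suc k"
    unfolding eq card_insert_disjoint[OF finite.insertI[OF fin] n(2)] card_insert_disjoint[OF fin n(1)] B(3)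
    by simp
  moreover have "v \<notin> B" using n(1) by blast
  then have "card (insert v B) = Suc k" using B(1,2) by (metis card_insert_disjoint)
  moreover have "independent (insert v B \<union> J ` insert v B)" unfolding eq by (rule ext(1))
  moreover have "finite (insert v B)" using B(1) by simp
  ultimately show ?case by blast
qed

lemma standard_complex_coordinates:
  fixes J :: "'v::real_vector \<Rightarrow> 'v"
  assumes J: "linear J" "\<And>x. J (J x) = - x" and dim: "dim (UNIV :: 'v set) = 2 * CARD('n::finite)"
  obtains L :: "'n::finite xy_space \<Rightarrow> 'v" where "linear L" "bij L" "\<And>a. L (standard_J a) = J (L a)"
proof -
  let ?n = "CARD('n)"
  obtain B where B: "finite B" "card B = ?n" "card (B \<union> J ` B) = 2 * ?n" "independent (B \<union> J ` B)"
    using complex_basis_exists[OF J dim, of ?n] by auto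
  have injJ: "inj_on J S" for S by (rule inj_onI) (metis J(2) minus_equation_iff)
  \<comment> \<open>The union has as many elements as \<open>B\<close> and its image together, which
    forces disjointness.\<close>
  have "card (B \<inter> J ` B) = 0"
    using card_Un_Int[of B "J ` B"] B card_image[OF injJ, of B] by simp
  then have disj: "B \<inter> J ` B = {}" using B(1) by simp
  \<comment> \<open>A vector outside the span would give one more than \<open>2 * ?n\<close>
    independent vectors inside the span of \<open>2 * ?n\<close> vectors.\<close>
  have span: "span (B \<union> J ` B) = UNIV"
  proof (rule ccontr)
    assume "span (B \<union> J ` B) \<noteq> UNIV"
    then obtain v where v: "v \<notin> span (B \<union> J ` B)" by blast
    then have ind: "independent (insert v (B \<union> J ` B))" using B(4) by (meson independent_insertI)
    obtain D where D: "D \<subseteq> (UNIV :: 'v set)" "independent D" "UNIV \<subseteq> span D" "card D = 2 * ?n"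
      using basis_exists[of "UNIV :: 'v set"] dim by metis
    have "finite D" using D(4) by (intro card_ge_0_finite) simp
    moreover have "insert v (B \<union> J ` B) \<subseteq> span D" using D(3) by blast
    ultimately have le: "card (insert v (B \<union> J ` B)) \<le> 2 * ?n"
      using independent_span_bound[OF _ ind] D(4) by metis
    have "v \<notin> B \<union> J ` B" by (rule contrapos_nn[OF v span_base], assumption)
    moreover have "finite (B \<union> J ` B)" using B(1) by blast
    ultimately show False using le B(3) by (metis card_insert_disjoint not_less_eq_eq order_refl)
  qed
  obtain f :: "'n::finite \<Rightarrow> 'v" where f: "bij_betw f UNIV B"
    using finite_same_card_bij[of "UNIV :: 'n set" B] B by auto
  then have f_inj: "inj f" and f_ran: "range f = B" by (auto simp: bij_betw_def)
  define L :: "'n xy_space \<Rightarrow> 'v" where "L a = (\<Sum>i\<in>UNIV. fst a $ i *\<^sub>R f i + snd a $ i *\<^sub>R J (f i))" for a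
  have linL: "linear L"
    unfolding L_def by (auto intro!: linearI simp: scaleR_add_left sum.distrib scaleR_sum_right scaleR_add_right)
  have LJ: "L (standard_J a) = J (L a)" for a
    unfolding L_def standard_J_def
    by (simp add: linear_sum[OF J(1)] linear_add[OF J(1)] linear_scale[OF J(1)] J(2) add.commute)
  have ax: "L (axis i 1, 0) = f i" for i
    unfolding L_def by (simp add: axis_def if_distrib[of "\<lambda>x. x *\<^sub>R _"] cong: if_cong)
  then have ax': "L (0, axis i 1) = J (f i)" for i using LJ[of "(axis i 1, 0)"] by (simp add: standard_J_axis)
  \<comment> \<open>The values on the basis of a left inverse of \<open>L\<close>: for
    \<open>v = J (f i)\<close> the vector \<open>- J v\<close> is \<open>f i\<close>.\<close>
  define e where "e v = (if v \<in> B then (axis (inv f v) 1, 0) else (0, axis (inv f (- J v)) 1) :: 'n xy_space)" for v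
  obtain \<phi> where \<phi>: "linear \<phi>" "\<forall>v\<in>B \<union> J ` B. \<phi> v = e v"
    using linear_independent_extend[OF B(4), of e] by blast
  have \<phi>f: "\<phi> (f i) = (axis i 1, 0)" for i
    using \<phi>(2) f_ran f_inj unfolding e_def by (metis UnI1 inv_f_f rangeI)
  have \<phi>Jf: "\<phi> (J (f i)) = (0, axis i 1)" for i
  proof -
    have "f i \<in> B" using f_ran by blast
    then have "J (f i) \<in> J ` B" by blast
    then have "J (f i) \<notin> B" "\<phi> (J (f i)) = e (J (f i))" using disj \<phi>(2) by blast+
    then show ?thesis unfolding e_def by (simp add: J(2) inv_f_f[OF f_inj])
  qed
  have "\<phi> (L a) = a" for a
  proof -
    have "\<phi> (L b) = b" if b: "b \<in> Basis" for b
    proof -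
      consider i where "b = (axis i 1, 0)" | i where "b = (0, axis i 1)"
        using b by (auto simp: Basis_prod_def Basis_vec_def)
      then show ?thesis by cases (simp_all add: ax ax' \<phi>f \<phi>Jf)
    qed
    then have "(\<lambda>a. \<phi> (L a)) = (\<lambda>a. a)"
      using linear_compose[OF linL \<phi>(1)] linear_ident by (intro linear_eq_stdbasis) (auto simp: o_def)
    then show ?thesis by metis
  qed
  then have "inj L" by (metis injI)
  have "B \<union> J ` B \<subseteq> range L"
  proof
    fix v assume "v \<in> B \<union> J ` B"
    then obtain i where "v = f i \<or> v = J (f i)" using f_ran by blast
    then show "v \<in> range L" using ax[of i] ax'[of i] by (metis rangeI)
  qed
  then have "surj L" using span span_minimal[OF _ linear_subspace_image[OF linL subspace_UNIV]] by blast
  with \<open>inj L\<close> linL LJ that show thesis by (simp add: bij_def)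
qed

section \<open>Smoothness of polynomials of degree at most two\<close>

lemma smooth_on_const: "smooth_on S (\<lambda>_. c)"
proof -
  have "k_smooth_on k S (\<lambda>_. c)" for k
    by (induction k arbitrary: c) (simp_all add: frechet_derivative_const)
  then show ?thesis by (simp add: smooth_on_def)
qed

lemma smooth_on_linear:
  fixes f :: "'a::euclidean_space \<Rightarrow> 'b::real_normed_vector"
  assumes "linear f"
  shows "smooth_on S f"
proof -
  have d: "(f has_derivative f) (at x)" for x
    using assms by (simp add: linear_imp_has_derivative)
  have "k_smooth_on k S f" for k
  proof (cases k)
    case 0
    then show ?thesis using linear_continuous_on[of f S] assms by (simp add: linear_conv_bounded_linear)
  next
    case (Suc k')
    have "k_smooth_on k' S (\<lambda>_. f v)" for v using smooth_on_const unfolding smooth_on_def by blast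
    then show ?thesis using d Suc pd_eqI[OF d] by (auto simp: differentiable_def)
  qed
  then show ?thesis by (simp add: smooth_on_def)
qed

lemma has_derivative_quadratic:
  fixes S :: "'a::euclidean_space \<Rightarrow> 'a \<Rightarrow> real"
  assumes "bilinear S"
  shows "((\<lambda>q. c + S q q) has_derivative (\<lambda>v. S v q + S q v)) (at q)"
proof -
  have "bounded_bilinear S" using assms by (simp add: bilinear_conv_bounded_bilinear)
  from bounded_bilinear.FDERIV[OF this has_derivative_ident has_derivative_ident]
  have "((\<lambda>q. S q q) has_derivative (\<lambda>v. S q v + S v q)) (at q)" .
  from has_derivative_add[OF has_derivative_const this]
  show ?thesis by (simp add: add.commute)
qed

lemma linear_pd_quadratic:
  fixes S :: "'a::euclidean_space \<Rightarrow> 'a \<Rightarrow> real"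
  assumes "bilinear S"
  shows "linear (\<lambda>q. S v q + S q v)"
  using assms by (simp add: bilinear_def linear_compose_add)

lemma smooth_on_quadratic:
  fixes S :: "'a::euclidean_space \<Rightarrow> 'a \<Rightarrow> real"
  assumes "bilinear S"
  shows "smooth_on U (\<lambda>q. c + S q q)"
proof -
  note d = has_derivative_quadratic[OF assms]
  have "k_smooth_on k U (\<lambda>q. c + S q q)" for k
  proof (cases k)
    case 0
    have "continuous_on U (\<lambda>q. c + S q q)"
      using d has_derivative_continuous by (intro continuous_at_imp_continuous_on) blast
    then show ?thesis using 0 by simp
  next
    case (Suc k')
    have "k_smooth_on k' U (\<lambda>q. S v q + S q v)" for v
      using smooth_on_linear[OF linear_pd_quadratic[OF assms]] unfolding smooth_on_def by blast
    then show ?thesis using d Suc pd_eqI[OF d] by (auto simp: differentiable_def)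
  qed
  then show ?thesis by (simp add: smooth_on_def)
qed

section \<open>Open sets of the coordinate space as Hermitian manifolds\<close>

lemma second_countable_euclidean: "second_countable (euclidean :: 'a::second_countable_topology topology)"
proof -
  obtain B :: "'a set set" where B: "countable B" "\<And>C. C \<in> B \<Longrightarrow> open C"
    "\<And>S. open S \<Longrightarrow> \<exists>V. V \<subseteq> B \<and> S = \<Union>V"
    by (rule univ_second_countable) blast
  have "\<exists>V\<in>B. x \<in> V \<and> V \<subseteq> S" if "open S" "x \<in> S" for S x
    using B(3)[OF that(1)] that(2) by blast
  with B(1,2) show ?thesis unfolding second_countable_def by auto
qed

text \<open>The tangent components in all charts other than the single identity chart vanish by
  convention.\<close>

definition domain_manifold ::
    "'n::finite xy_space set \<Rightarrow> ('n xy_space \<Rightarrow> 'n xy_space \<Rightarrow> 'n xy_space \<Rightarrow> real) \<Rightarrow>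
     ('n xy_space, 'n xy_space) almost_hermitian" where
  "domain_manifold U h = \<lparr>mtop = top_of_set U, atlas = {(U, \<lambda>q. q)},
     metric = (\<lambda>q u v. h q (u (U, \<lambda>q. q)) (v (U, \<lambda>q. q))),
     acs = (\<lambda>q u d. if d = (U, \<lambda>q. q) then standard_J (u (U, \<lambda>q. q)) else 0)\<rparr>"

locale hermitian_domain = chart_metric U h for U :: "'n::finite xy_space set" and h +
  assumes hJ: "\<And>q a b. q \<in> U \<Longrightarrow> h q (standard_J a) (standard_J b) = h q a b"
begin

abbreviation M :: "('n xy_space, 'n xy_space) almost_hermitian" where "M \<equiv> domain_manifold U h"
abbreviation c :: "('n xy_space, 'n xy_space) chart" where "c \<equiv> (U, \<lambda>q. q)"

lemma M_simps [simp]: "mtop M = top_of_set U" "atlas M = {c}" "metric M q u v = h q (u c) (v c)"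
  "acs M q u d = (if d = c then standard_J (u c) else 0)"
  by (simp_all add: domain_manifold_def)

lemma chart_inv_c [simp]: "q \<in> U \<Longrightarrow> inv_into U (\<lambda>q. q) q = q"
  using inv_into_f_f[of "\<lambda>q. q" U q] by simp

lemma chart_on_c: "chart_on (mtop M) c"
  using openU homeomorphic_map_id[of "top_of_set U"] by (simp add: chart_on_def id_def subtopology_subtopology)

lemma transition_c: "q \<in> U \<Longrightarrow> transition c c q = q"
  by (simp add: transition_def)

lemma pd_transition_c: "q \<in> U \<Longrightarrow> pd a (transition c c) q = a"
  using pd_transition_self[OF chart_on_c, of q a] by simp

lemma smooth_manifold_M: "smooth_manifold M"
proof -
  have "smooth_on U (\<lambda>q. q)" by (rule smooth_on_linear[OF linear_ident])
  then have "smooth_on U (transition c c)"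
    by (rule smooth_on_cong[OF openU]) (simp add: transition_c)
  then have "compatible c c" by (simp add: compatible_def)
  moreover have "Hausdorff_space (top_of_set U)"
    by (rule Hausdorff_space_subtopology) (rule Hausdorff_space_euclidean)
  moreover have "second_countable (top_of_set U)"
    by (rule second_countable_subtopology) (rule second_countable_euclidean)
  ultimately show ?thesis using chart_on_c by (simp add: smooth_manifold_def local_coordinates_def)
qed

lemma charts_at_M: "q \<in> U \<Longrightarrow> charts_at M q = {c}"
  by (auto simp: charts_at_def)

lemma tangent_space_M: "q \<in> U \<Longrightarrow> tangent_space M q = {u. \<forall>d. d \<noteq> c \<longrightarrow> u d = 0}"
  by (simp add: tangent_space_def charts_at_M pd_transition_c)

lemma coord_vec_M: "q \<in> U \<Longrightarrow> coord_vec M c q a = (\<lambda>d. if d = c then a else 0)"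
  by (auto simp: coord_vec_def charts_at_M pd_transition_c)

lemma metric_in_chart_M: "q \<in> U \<Longrightarrow> metric_in_chart M c q a b = h q a b"
  by (simp add: metric_in_chart_def coord_vec_M)

lemma riemannian_metric_M: "riemannian_metric M"
proof -
  have "u c \<noteq> 0" if "q \<in> U" "u \<in> tangent_space M q" "u \<noteq> (\<lambda>c. 0)" for q u
    using that tangent_space_M by (metis (mono_tags, lifting) mem_Collect_eq ext)
  moreover have "smooth_on U (\<lambda>q. metric_in_chart M c q a b)" for a b
    by (rule smooth_on_cong[OF openU smooth]) (simp add: metric_in_chart_M)
  moreover have "metric M q (tlincomb r u s v) w = r * metric M q u w + s * metric M q v w"
    if "q \<in> U" for q r u s v w
    by (simp add: tlincomb_def bilinear_ladd[OF bil[OF that]] bilinear_lmul[OF bil[OF that]])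
  ultimately show ?thesis
    unfolding riemannian_metric_def using h_sym pos by simp
qed

lemma almost_complex_structure_M: "almost_complex_structure M"
proof -
  have "smooth_on U (\<lambda>q. acs_in_chart M c q a)" for a
    by (rule smooth_on_cong[OF openU smooth_on_const[of _ "standard_J a"]])
      (simp add: acs_in_chart_def coord_vec_M)
  moreover have "acs M q u \<in> tangent_space M q"
    "acs M q (tlincomb r u s v) = tlincomb r (acs M q u) s (acs M q v)"
    "acs M q (acs M q u) = (\<lambda>d. - u d)"
    if q: "q \<in> U" and u: "u \<in> tangent_space M q" for q r u s v
  proof -
    show "acs M q u \<in> tangent_space M q" unfolding tangent_space_M[OF q] by simp
    show "acs M q (tlincomb r u s v) = tlincomb r (acs M q u) s (acs M q v)"
      by (rule ext) (simp only: M_simps tlincomb_def linear_add[OF standard_J(1)]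
        linear_scale[OF standard_J(1)] if_distrib scaleR_zero_right add_0_left split: if_split, simp)
    show "acs M q (acs M q u) = (\<lambda>d. - u d)"
    proof
      fix d show "acs M q (acs M q u) d = - u d"
      proof (cases "d = c")
        case True
        then show ?thesis by (simp only: M_simps standard_J(2) simp_thms if_True)
      next
        case False
        then have "u d = 0" using u unfolding tangent_space_M[OF q] by blast
        then show ?thesis using False by (simp only: M_simps simp_thms if_False neg_0_equal_iff_equal)
      qed
    qed
  qed
  ultimately show ?thesis
    unfolding almost_complex_structure_def by simp
qed

text \<open>The complex structure is the constant \<open>standard_J\<close> in the identity chart,
  which therefore provides adapted coordinates around every point.\<close>

lemma hermitian_manifold_M: "hermitian_manifold M"
proof -
  have "local_coordinates M c" using smooth_manifold_M by (simp add: smooth_manifold_def)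
  then have "integrable_acs M"
    unfolding integrable_acs_def
    by (intro ballI exI[of _ c]) (auto simp: fun_eq_iff coord_vec_M standard_J_axis)
  then show ?thesis
    using smooth_manifold_M riemannian_metric_M almost_complex_structure_M hJ
    by (simp add: hermitian_manifold_def almost_hermitian_manifold_def)
qed

text \<open>Where the first derivatives of the metric vanish, so do the covariant derivatives of the
  coordinate fields, and only the second derivatives in \<open>Riem_eq\<close> for the identity
  frame remain.\<close>

lemma riemann_tensor_M:
  assumes q: "q \<in> U" and d1: "\<And>a b s. pd s (\<lambda>p. h p a b) q = 0"
  shows "2 * riemann_tensor M q x y z w =
    pd (x c) (pd (z c) (\<lambda>p. h p (y c) (w c))) q - pd (x c) (pd (w c) (\<lambda>p. h p (y c) (z c))) q
    - pd (y c) (pd (z c) (\<lambda>p. h p (x c) (w c))) q + pd (y c) (pd (w c) (\<lambda>p. h p (x c) (z c))) q"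
proof -
  \<comment> \<open>This agrees with \<open>h\<close> on \<open>U\<close>, so derivatives at points
    of \<open>U\<close> are compared by locality.\<close>
  let ?h = "metric_in_chart M c"
  have cm: "chart_metric U ?h"
    using chart_metric_metric_in_chart[OF smooth_manifold_M riemannian_metric_M, of c] by simp
  interpret F: chart_frame U ?h U "\<lambda>q. q"
    using cm openU smooth_on_linear[OF linear_ident]
    by (simp add: chart_frame_def chart_frame_axioms_def)
  have X: "F.X a q = a" for a q by (rule pd_eqI[OF has_derivative_ident])
  have H: "F.H a b p = h p a b" if "p \<in> U" for a b p
    unfolding F.H_def X using that by (rule metric_in_chart_M)
  have dH: "pd s (F.H a b) p = pd s (\<lambda>p. h p a b) p" if "p \<in> U" for a b s p
    by (rule pd_cong_open[OF openU that H])
  have ddH: "pd r (pd s (F.H a b)) q = pd r (pd s (\<lambda>p. h p a b)) q" for a b r s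
    by (rule pd_cong_open[OF openU q dH])
  have "F.nabla (F.X a) b q = 0" for a b
  proof (rule F.h_eqI[OF q])
    fix v
    have "2 * ?h q (F.nabla (F.X a) b q) (F.X v q) = 0"
      unfolding F.koszul_H[OF q] by (simp add: dH[OF q] d1)
    then show "?h q (F.nabla (F.X a) b q) v = ?h q 0 v"
      by (simp add: X bilinear_lzero[OF F.bil[OF q]])
  qed
  then have "2 * F.Riem q (x c) (y c) (z c) (w c) =
    pd (x c) (pd (z c) (\<lambda>p. h p (y c) (w c))) q - pd (x c) (pd (w c) (\<lambda>p. h p (y c) (z c))) q
    - pd (y c) (pd (z c) (\<lambda>p. h p (x c) (w c))) q + pd (y c) (pd (w c) (\<lambda>p. h p (x c) (z c))) q"
    unfolding F.Riem_eq[OF q] ddH by (simp add: bilinear_lzero[OF F.bil[OF q]])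
  moreover have "riemann_tensor M q x y z w = F.Riem q (x c) (y c) (z c) (w c)"
    unfolding riemann_tensor_def F.Riem_def X Let_def by (simp add: charts_at_M[OF q])
  ultimately show ?thesis by simp
qed

end

section \<open>Positive definiteness near the origin\<close>

text \<open>By compactness of the unit sphere, \<open>g a a\<close> is at least a positive multiple
  of the squared norm of \<open>a\<close>, while the perturbation is at most that squared norm times
  a multiple of the squared norm of \<open>q\<close>.\<close>

lemma positive_definite_perturbation:
  fixes g :: "'a::euclidean_space \<Rightarrow> 'a \<Rightarrow> real" and T :: "'a \<Rightarrow> 'a \<Rightarrow> 'a \<Rightarrow> 'a \<Rightarrow> real"
  assumes g: "bilinear g" "\<And>a. a \<noteq> 0 \<Longrightarrow> g a a > 0"
    and T1: "\<And>a b. bilinear (\<lambda>q q'. T q q' a b)" and T2: "\<And>q q'. bilinear (T q q')"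
  obtains r where "r > 0" "\<And>q a. \<lbrakk>q \<in> ball 0 r; a \<noteq> 0\<rbrakk> \<Longrightarrow> g a a + T q q a a > 0"
proof -
  have "continuous_on (sphere 0 1) (\<lambda>a. 0 + g a a)"
    using has_derivative_continuous[OF has_derivative_quadratic[OF g(1)]]
    by (intro continuous_at_imp_continuous_on) blast
  then have cont: "continuous_on (sphere 0 1) (\<lambda>a. g a a)" by simp
  obtain u :: 'a where "norm u = 1" using vector_choose_size[of 1] by auto
  then have "u \<in> sphere 0 1" by simp
  then have "sphere (0::'a) 1 \<noteq> {}" by blast
  from continuous_attains_inf[OF compact_sphere this cont]
  obtain v where v: "v \<in> sphere (0::'a) 1" "\<And>a. a \<in> sphere 0 1 \<Longrightarrow> g v v \<le> g a a" by blast
  define m where "m = g v v"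
  have "v \<noteq> 0" using v(1) by auto
  then have m: "m > 0" unfolding m_def by (rule g(2))
  have low: "m * (norm a)\<^sup>2 \<le> g a a" for a
  proof (cases "a = 0")
    case False
    let ?b = "(1 / norm a) *\<^sub>R a"
    have "m \<le> g ?b ?b" unfolding m_def using False by (intro v(2)) simp
    also have "\<dots> = g a a / (norm a)\<^sup>2"
      by (simp add: bilinear_lmul[OF g(1)] bilinear_rmul[OF g(1)] power2_eq_square)
    finally show ?thesis using False by (simp add: field_simps)
  qed (simp add: bilinear_lzero[OF g(1)])
  have "\<exists>B>0. \<forall>a b. norm (T i j a b) \<le> B * norm a * norm b" for i j
    using bilinear_bounded_pos[OF T2] by blast
  then obtain B where B: "\<And>i j. B i j > 0" "\<And>i j a b. norm (T i j a b) \<le> B i j * norm a * norm b"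
    by metis
  define C where "C = (\<Sum>i\<in>Basis. \<Sum>j\<in>Basis. B i j)"
  have "C \<ge> 0" unfolding C_def by (intro sum_nonneg less_imp_le B)
  have up: "\<bar>T q q a a\<bar> \<le> (norm q)\<^sup>2 * C * (norm a)\<^sup>2" for q a
  proof -
    have "\<bar>T q q a a\<bar> = \<bar>\<Sum>i\<in>Basis. \<Sum>j\<in>Basis. ((q \<bullet> i) * (q \<bullet> j)) *\<^sub>R T i j a a\<bar>"
      by (subst bilinear_Basis_expand[OF T1]) simp
    also have "\<dots> \<le> (\<Sum>i\<in>Basis. \<Sum>j\<in>Basis. \<bar>((q \<bullet> i) * (q \<bullet> j)) *\<^sub>R T i j a a\<bar>)"
      by (intro order_trans[OF sum_abs] sum_mono) (rule order_refl)
    also have "\<dots> \<le> (\<Sum>i\<in>Basis. \<Sum>j\<in>Basis. (norm q * norm q) * (B i j * norm a * norm a))"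
    proof (intro sum_mono)
      fix i j :: 'a assume "i \<in> Basis" "j \<in> Basis"
      then have "\<bar>q \<bullet> i\<bar> \<le> norm q" "\<bar>q \<bullet> j\<bar> \<le> norm q" by (simp_all add: Basis_le_norm)
      then show "\<bar>((q \<bullet> i) * (q \<bullet> j)) *\<^sub>R T i j a a\<bar> \<le> (norm q * norm q) * (B i j * norm a * norm a)"
        using B(2)[of i j a a] by (simp add: abs_mult mult_mono)
    qed
    also have "\<dots> = (norm q)\<^sup>2 * C * (norm a)\<^sup>2"
      unfolding C_def by (simp add: sum_distrib_left sum_distrib_right power2_eq_square mult.assoc)
    finally show ?thesis .
  qed
  \<comment> \<open>The bound 1 allows the square of \<open>norm q\<close> to be replaced by
    \<open>norm q\<close>; \<open>C + 1\<close> avoids division by zero.\<close>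
  define r where "r = min 1 (m / (C + 1))"
  have "r > 0" using m \<open>C \<ge> 0\<close> by (simp add: r_def)
  moreover have "g a a + T q q a a > 0" if "q \<in> ball 0 r" "a \<noteq> 0" for q a
  proof -
    have q: "norm q < 1" "norm q < m / (C + 1)" using that(1) by (auto simp: r_def)
    have "(norm q)\<^sup>2 * C \<le> norm q * (C + 1)"
      using q(1) \<open>C \<ge> 0\<close> mult_left_le[of "norm q" "norm q"]
      by (intro mult_mono) (auto simp: power2_eq_square)
    also have "\<dots> < m" using q(2) \<open>C \<ge> 0\<close> by (simp add: pos_less_divide_eq)
    finally have "(norm q)\<^sup>2 * C * (norm a)\<^sup>2 < m * (norm a)\<^sup>2"
      using that(2) by (intro mult_strict_right_mono) auto
    then show ?thesis using low[of a] up[of q a] by linarith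
  qed
  ultimately show thesis by (rule that)
qed

section \<open>The realizing manifold\<close>

theorem gray_realizable:
  fixes ip :: "'v::real_vector \<Rightarrow> 'v \<Rightarrow> real"
  assumes model: "complex_curvature_model CARD('n::finite) ip J A" and gray: "A \<in> gray_space J"
  shows "\<exists>(M :: ('n xy_space, 'n xy_space) almost_hermitian) P.
    hermitian_manifold M \<and> geometrically_realized ip J A M P"
proof -
  have dim: "dim (UNIV :: 'v set) = 2 * CARD('n)" and A: "A \<in> curvature_tensors"
    and i: "inner_product_on_space ip" and j: "hermitian_complex_structure ip J"
    using model by (simp_all only: complex_curvature_model_def)
  note i' = i[unfolded inner_product_on_space_def] and j' = j[unfolded hermitian_complex_structure_def]
  have ip: "linear (ip x)" for x by (rule i'[THEN conjunct1, THEN spec])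
  have ip_sym: "ip x y = ip y x" for x y by (rule i'[THEN conjunct2, THEN conjunct1, THEN spec, THEN spec])
  have ip_pos: "ip x x > 0" if "x \<noteq> 0" for x
    using i'[THEN conjunct2, THEN conjunct2, THEN spec] that by (rule mp)
  have J: "linear J" "J (J x) = - x" for x
    by (rule j'[THEN conjunct1]) (rule j'[THEN conjunct2, THEN conjunct1, THEN spec])
  have ipJ: "ip (J x) (J y) = ip x y" for x y
    by (rule j'[THEN conjunct2, THEN conjunct2, THEN spec, THEN spec])
  obtain L :: "'n xy_space \<Rightarrow> 'v" where L: "linear L" "bij L" "\<And>a. L (standard_J a) = J (L a)"
    using standard_complex_coordinates[OF J dim] by blast
  \<comment> \<open>The inner product and \<open>theta\<close> are transported to the coordinate
    space by the complex linear isomorphism \<open>L\<close>; the point enters both first slots of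
    \<open>T\<close>.\<close>
  define g where "g a b = ip (L a) (L b)" for a b
  define T where "T q q' a b = theta J A (L q) (L q') (L a) (L b)" for q q' a b
  define h where "h q a b = g a b + T q q a b" for q a b
  have ip': "linear (\<lambda>x. ip x y)" for y using ip[of y] by (subst ip_sym)
  have L0: "L a \<noteq> 0" if "a \<noteq> 0" for a
    using that L(1,2) linear_injective_0 bij_def by blast
  have g: "bilinear g" "g a b = g b a" "g (standard_J a) (standard_J b) = g a b" "a \<noteq> 0 \<Longrightarrow> g a a > 0" for a b
  proof -
    show "bilinear g"
      using linear_compose[OF L(1) ip] linear_compose[OF L(1) ip']
      unfolding g_def bilinear_def by (simp add: o_def)
    show "g a b = g b a" unfolding g_def by (rule ip_sym)
    show "g (standard_J a) (standard_J b) = g a b" unfolding g_def L(3) by (rule ipJ)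
    show "a \<noteq> 0 \<Longrightarrow> g a a > 0" unfolding g_def by (rule ip_pos[OF L0])
  qed
  have t: "linear (\<lambda>a. theta J A a c b d)" "linear (\<lambda>c. theta J A a c b d)"
    "linear (\<lambda>b. theta J A a c b d)" "linear (\<lambda>d. theta J A a c b d)" for a b c d
  proof -
    show "linear (\<lambda>a. theta J A a c b d)" "linear (\<lambda>b. theta J A a c b d)" by (rule linear_theta[OF A J(1)])+
    then show "linear (\<lambda>c. theta J A a c b d)" "linear (\<lambda>d. theta J A a c b d)"
      using linear_theta[OF A J(1)] by (subst theta_sym; assumption | subst theta_sym; blast)+
  qed
  have T1: "bilinear (\<lambda>q q'. T q q' a b)" for a b
    unfolding bilinear_def T_def using linear_compose[OF L(1) t(1)] linear_compose[OF L(1) t(2)] by (simp add: o_def)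
  have T2: "bilinear (T q q')" for q q'
    unfolding bilinear_def T_def using linear_compose[OF L(1) t(3)] linear_compose[OF L(1) t(4)] by (simp add: o_def)
  obtain r where r: "r > 0" "\<And>q a. \<lbrakk>q \<in> ball 0 r; a \<noteq> 0\<rbrakk> \<Longrightarrow> g a a + T q q a a > 0"
    using positive_definite_perturbation[OF g(1,4) T1 T2] by blast
  interpret D: hermitian_domain "ball 0 r" h
  proof
    show "open (ball 0 r)" by simp
    fix q a b
    show "bilinear (h q)"
      using g(1) T2[of q q] unfolding h_def bilinear_def by (simp add: linear_compose_add)
    show "h q a b = h q b a" unfolding h_def T_def using g(2) theta_sym(2) by metis
    show "smooth_on (ball 0 r) (\<lambda>p. h p a b)" unfolding h_def by (rule smooth_on_quadratic[OF T1])
    show "h q (standard_J a) (standard_J b) = h q a b"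
      unfolding h_def T_def L(3) theta_hermitian[OF A J(2)] g(3) ..
    show "h q a a > 0" if "q \<in> ball 0 r" "a \<noteq> 0" unfolding h_def using that by (rule r(2))
  qed
  have 0: "0 \<in> ball (0 :: 'n xy_space) r" using r(1) by simp
  have dh: "pd s (\<lambda>p. h p a b) q = T s q a b + T q s a b" for s a b q
    unfolding h_def by (rule pd_eqI[OF has_derivative_quadratic[OF T1]])
  have ddh: "pd s' (pd s (\<lambda>p. h p a b)) 0 = 2 * T s' s a b" for s s' a b
  proof -
    have "pd s' (\<lambda>q. T s q a b + T q s a b) 0 = T s s' a b + T s' s a b"
      by (rule pd_eqI[OF linear_imp_has_derivative[OF linear_pd_quadratic[OF T1]]])
    \<comment> \<open>Symmetry in the point slots makes the second derivative \<open>2 * T\<close>,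
      which accounts for the factor 2 in \<open>riemann_tensor_M\<close>.\<close>
    also have "T s s' a b = T s' s a b" unfolding T_def by (rule theta_sym)
    finally show ?thesis unfolding dh by simp
  qed
  have R: "riemann_tensor D.M 0 x y z w = A (L (x D.c)) (L (y D.c)) (L (z D.c)) (L (w D.c))" for x y z w
  proof -
    have "pd s (\<lambda>p. h p a b) 0 = 0" for s a b
      unfolding dh using bilinear_lzero[OF T1] bilinear_rzero[OF T1] by simp
    from D.riemann_tensor_M[OF 0 this, of x y z w] show ?thesis
      unfolding ddh
      using theta_curvature[OF gray J(2), of "L (x D.c)" "L (z D.c)" "L (y D.c)" "L (w D.c)"]
      unfolding T_def by linarith
  qed
  define F where "F = inv L"
  have LF: "L (F x) = x" and FL: "F (L a) = a" for x a
    using L(2) by (simp_all add: F_def bij_is_surj surj_f_inv_f bij_is_inj)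
  have linF: "F (r *\<^sub>R x + s *\<^sub>R y) = r *\<^sub>R F x + s *\<^sub>R F y" for r s x y
    using FL[of "r *\<^sub>R F x + s *\<^sub>R F y"] by (simp add: linear_add[OF L(1)] linear_scale[OF L(1)] LF)
  have FJ: "F (J x) = standard_J (F x)" for x using L(3)[of "F x"] FL LF by metis
  \<comment> \<open>Outside the only chart the value must be zero for \<open>\<phi> x\<close> to be
    a tangent vector.\<close>
  define \<phi> where "\<phi> x d = (if d = D.c then F x else 0)" for x d
  have \<phi>c: "\<phi> x D.c = F x" for x by (simp add: \<phi>_def)
  have "bij_betw \<phi> UNIV (tangent_space D.M 0)"
  proof (rule bij_betw_byWitness[where f' = "\<lambda>u. L (u D.c)"])
    show "\<forall>x\<in>UNIV. L (\<phi> x D.c) = x" by (simp only: \<phi>c LF) simp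
    show "\<forall>u\<in>tangent_space D.M 0. \<phi> (L (u D.c)) = u"
    proof (intro ballI ext)
      fix u d assume "u \<in> tangent_space D.M 0"
      then have "d \<noteq> D.c \<Longrightarrow> u d = 0" unfolding D.tangent_space_M[OF 0] by blast
      then show "\<phi> (L (u D.c)) d = u d" unfolding \<phi>_def FL by (cases "d = D.c") (simp_all only: simp_thms if_True if_False)
    qed
    show "\<phi> ` UNIV \<subseteq> tangent_space D.M 0"
    proof (rule image_subsetI)
      fix x show "\<phi> x \<in> tangent_space D.M 0"
        unfolding D.tangent_space_M[OF 0] mem_Collect_eq \<phi>_def by (intro allI impI) (simp only: if_False)
    qed
  qed simp
  moreover have "\<phi> (r *\<^sub>R x + s *\<^sub>R y) = tlincomb r (\<phi> x) s (\<phi> y)" for x y r s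
    unfolding \<phi>_def[abs_def] tlincomb_def linF by auto
  moreover have "ip x y = metric D.M 0 (\<phi> x) (\<phi> y)" for x y
    unfolding D.M_simps \<phi>c h_def g_def LF using bilinear_lzero[OF T1] by simp
  moreover have "\<phi> (J x) = acs D.M 0 (\<phi> x)" for x
    by (rule ext) (simp only: D.M_simps FJ \<phi>_def simp_thms if_True)
  moreover have "A x y z w = riemann_tensor D.M 0 (\<phi> x) (\<phi> y) (\<phi> z) (\<phi> w)" for x y z w
    unfolding R \<phi>c LF ..
  ultimately have "geometrically_realized ip J A D.M 0"
    unfolding geometrically_realized_def using 0 by (auto intro!: exI[of _ \<phi>])
  then show ?thesis using D.hermitian_manifold_M by blast
qed

text \<open>An existential statement cannot range over types of points. The realizing manifold is
  therefore sought with points in the coordinate space, and the second conjunct gives the converse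
  for an arbitrary type \<open>'m\<close> of points.\<close>

theorem theorem1p4:
  fixes ip :: "'v::real_vector \<Rightarrow> 'v \<Rightarrow> real"
    and J :: "'v \<Rightarrow> 'v"
    and A :: "'v \<Rightarrow> 'v \<Rightarrow> 'v \<Rightarrow> 'v \<Rightarrow> real"
  assumes "complex_curvature_model CARD('n::finite) ip J A"
  shows "(A \<in> gray_space J \<longleftrightarrow>
            (\<exists>(M :: ('n xy_space, 'n xy_space) almost_hermitian) P.
               hermitian_manifold M \<and> geometrically_realized ip J A M P))
       \<and> (\<forall>(M :: ('m, 'n xy_space) almost_hermitian) P.
            hermitian_manifold M \<and> geometrically_realized ip J A M P \<longrightarrow> A \<in> gray_space J)"
proof (intro conjI iffI allI impI)
  have A: "A \<in> curvature_tensors" using assms by (simp add: complex_curvature_model_def)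
  show "\<exists>(M :: ('n xy_space, 'n xy_space) almost_hermitian) P.
      hermitian_manifold M \<and> geometrically_realized ip J A M P" if "A \<in> gray_space J"
    using assms that by (rule gray_realizable)
  show "A \<in> gray_space J" if "\<exists>(M :: ('n xy_space, 'n xy_space) almost_hermitian) P.
      hermitian_manifold M \<and> geometrically_realized ip J A M P"
    using that by (elim exE conjE) (rule hermitian_manifold_gray[OF A])
  show "A \<in> gray_space J" if "hermitian_manifold M \<and> geometrically_realized ip J A M P"
    for M :: "('m, 'n xy_space) almost_hermitian" and P
    using that by (elim conjE) (rule hermitian_manifold_gray[OF A])
qed

end
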